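(* Let $\mathcal{E}$ be a locally small cocomplete (elementary) topos, let $\Gamma\subseteq \mathrm{Sub}_{\mathcal{E}}(1)$ be a subframe of the frame $\mathrm{Sub}_{\mathcal{E}}(1)$ of subterminal objects of $\mathcal{E}$, and let $i:X\to P$ be an indexing function of a set $P$ of points of $\mathcal{E}$ by a set $X$. Let $\phi_{\Gamma,\mathcal{E}}:\Gamma\to\mathscr{P}(X)$ be the function $\phi_{\Gamma,\mathcal{E}}(u)=\{x\in X \mid i(x)^{\ast}(u)\cong 1_{\mathbf{Set}}\}$ and let $\tau^{\mathcal{E}}_{\Gamma,i}$ be its image. Then: (i) the collection $\tau^{\mathcal{E}}_{\Gamma,i}$ of subsets of $X$ is a topology on $X$; (ii) the collection $P$ of points separates the subterminals in $\Gamma$ if and only if the frame of open sets of the topology $\tau^{\mathcal{E}}_{\Gamma,i}$ on $X$ is isomorphic to the frame $\Gamma$ via the map $\phi_{\Gamma,\mathcal{E}}$. In particular, if $P$ separates the subterminals of $\mathcal{E}$ then $\phi_{\mathrm{Sub}_{\mathcal{E}}(1),\mathcal{E}}$ yields an isomorphism between $\mathrm{Sub}_{\mathcal{E}}(1)$ and the frame of open sets of the topology $\tau^{\mathcal{E}}_{\mathrm{Sub}_{\mathcal{E}}(1),i}$.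
   Context: A point of $\mathcal{E}$ is a geometric morphism $p:\mathbf{Set}\to\mathcal{E}$, with inverse image $p^{\ast}$; points are considered up to isomorphism. An indexing function of a set $P$ of points by a set $X$ is a surjective function $i:X\to P$. A subframe of a frame $A$ is a subset containing $0_A$ and $1_A$ and closed under arbitrary joins and finite meets of $A$. A collection $P$ of points of $\mathcal{E}$ separates the subterminals in $\Gamma$ if for any non-isomorphic $u,v\in\Gamma$ there is $p\in P$ with $p^{\ast}(u)\not\cong p^{\ast}(v)$; it separates the subterminals of $\mathcal{E}$ if this holds for $\Gamma=\mathrm{Sub}_{\mathcal{E}}(1)$. *)

theory Defs
  imports
    "HOL-Analysis.Abstract_Topology"
    "HOL-Library.Equipollence"
    "HOL-Algebra.Complete_Lattice"
begin

section \<open>Universes of small sets\<close>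

text \<open>
  HOL has no type of all sets, so the category of sets is taken relative to a Grothendieck
  universe. The sets are the members of a family \<open>U\<close> of subsets of a type, and the closure
  conditions are those of a universe, stated up to bijection. Being small depends only on the
  cardinality: \<open>U\<close> consists of the sets of cardinality below some \<open>\<kappa>\<close> that is either a strongly
  inaccessible cardinal or \<open>\<omega>\<close>. Nothing below depends on which of the two cases holds, and
  not demanding an infinite member means that universes provably exist in HOL.
\<close>

definition universe :: "'u set set \<Rightarrow> bool" where
  "universe U \<longleftrightarrow>
     U \<noteq> {} \<and>
     (\<forall>A\<in>U. \<forall>B. B \<lesssim> A \<longrightarrow> B \<in> U) \<and>
     (\<forall>A\<in>U. \<exists>B\<in>U. B \<approx> Pow A) \<and>
     (\<forall>A\<in>U. \<forall>F. (\<forall>a\<in>A. F a \<in> U) \<longrightarrow> (\<Union>a\<in>A. F a) \<in> U)"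

lemma universe_finite: "universe {A :: nat set. finite A}"
  unfolding universe_def
proof (intro conjI ballI allI impI)
  fix A :: "nat set" assume "A \<in> {A. finite A}"
  then have "{..<card (Pow A)} \<approx> Pow A"
    by (simp add: eqpoll_iff_card)
  then show "\<exists>B\<in>{A :: nat set. finite A}. B \<approx> Pow A"
    by (intro bexI[of _ "{..<card (Pow A)}"]) simp_all
next
  fix A B :: "nat set" assume "A \<in> {A. finite A}" "B \<lesssim> A"
  then show "B \<in> {A. finite A}" by (auto simp: lepoll_def intro: inj_on_finite)
qed auto

section \<open>Categories, functors, limits\<close>

record ('o, 'm) cat =
  Obj :: "'o set"
  Arr :: "'m set"
  Dom :: "'m \<Rightarrow> 'o"
  Cod :: "'m \<Rightarrow> 'o"
  Id :: "'o \<Rightarrow> 'm"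
  Comp :: "'m \<Rightarrow> 'm \<Rightarrow> 'm"  (infixl \<open>\<cdot>\<index>\<close> 70)

definition Hom :: "('o, 'm) cat \<Rightarrow> 'o \<Rightarrow> 'o \<Rightarrow> 'm set" where
  "Hom C a b = {f \<in> Arr C. Dom C f = a \<and> Cod C f = b}"

definition category :: "('o, 'm) cat \<Rightarrow> bool" where
  "category C \<longleftrightarrow>
     (\<forall>f\<in>Arr C. Dom C f \<in> Obj C \<and> Cod C f \<in> Obj C) \<and>
     (\<forall>a\<in>Obj C. Id C a \<in> Hom C a a) \<and>
     (\<forall>f\<in>Arr C. \<forall>g\<in>Arr C. Cod C f = Dom C g \<longrightarrow> g \<cdot>\<^bsub>C\<^esub> f \<in> Hom C (Dom C f) (Cod C g)) \<and>
     (\<forall>f\<in>Arr C. f \<cdot>\<^bsub>C\<^esub> Id C (Dom C f) = f \<and> Id C (Cod C f) \<cdot>\<^bsub>C\<^esub> f = f) \<and>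
     (\<forall>f\<in>Arr C. \<forall>g\<in>Arr C. \<forall>h\<in>Arr C. Cod C f = Dom C g \<longrightarrow> Cod C g = Dom C h \<longrightarrow>
        h \<cdot>\<^bsub>C\<^esub> (g \<cdot>\<^bsub>C\<^esub> f) = (h \<cdot>\<^bsub>C\<^esub> g) \<cdot>\<^bsub>C\<^esub> f)"

definition isomorphic :: "('o, 'm) cat \<Rightarrow> 'o \<Rightarrow> 'o \<Rightarrow> bool" where
  "isomorphic C a b \<longleftrightarrow>
     (\<exists>f\<in>Hom C a b. \<exists>g\<in>Hom C b a. g \<cdot>\<^bsub>C\<^esub> f = Id C a \<and> f \<cdot>\<^bsub>C\<^esub> g = Id C b)"

definition monic :: "('o, 'm) cat \<Rightarrow> 'm \<Rightarrow> bool" where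
  "monic C m \<longleftrightarrow> m \<in> Arr C \<and>
     (\<forall>c\<in>Obj C. \<forall>f\<in>Hom C c (Dom C m). \<forall>g\<in>Hom C c (Dom C m).
        m \<cdot>\<^bsub>C\<^esub> f = m \<cdot>\<^bsub>C\<^esub> g \<longrightarrow> f = g)"

record ('o1, 'm1, 'o2, 'm2) functor_data =
  on_obj :: "'o1 \<Rightarrow> 'o2"
  on_arr :: "'m1 \<Rightarrow> 'm2"

definition is_functor ::
  "('o1, 'm1) cat \<Rightarrow> ('o2, 'm2) cat \<Rightarrow> ('o1, 'm1, 'o2, 'm2) functor_data \<Rightarrow> bool" where
  "is_functor C D F \<longleftrightarrow> category C \<and> category D \<and>
     (\<forall>a\<in>Obj C. on_obj F a \<in> Obj D) \<and>
     (\<forall>f\<in>Arr C. on_arr F f \<in> Hom D (on_obj F (Dom C f)) (on_obj F (Cod C f))) \<and>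
     (\<forall>a\<in>Obj C. on_arr F (Id C a) = Id D (on_obj F a)) \<and>
     (\<forall>f\<in>Arr C. \<forall>g\<in>Arr C. Cod C f = Dom C g \<longrightarrow>
        on_arr F (g \<cdot>\<^bsub>C\<^esub> f) = on_arr F g \<cdot>\<^bsub>D\<^esub> on_arr F f)"

definition functor_comp ::
  "('o2, 'm2, 'o3, 'm3) functor_data \<Rightarrow> ('o1, 'm1, 'o2, 'm2) functor_data
     \<Rightarrow> ('o1, 'm1, 'o3, 'm3) functor_data" where
  "functor_comp G F = \<lparr>on_obj = on_obj G \<circ> on_obj F, on_arr = on_arr G \<circ> on_arr F\<rparr>"

definition naturally_isomorphic ::
  "('o1, 'm1) cat \<Rightarrow> ('o2, 'm2) cat \<Rightarrow> ('o1, 'm1, 'o2, 'm2) functor_data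
     \<Rightarrow> ('o1, 'm1, 'o2, 'm2) functor_data \<Rightarrow> bool" where
  "naturally_isomorphic C D F G \<longleftrightarrow>
     (\<exists>\<eta> \<epsilon>.
        (\<forall>a\<in>Obj C. \<eta> a \<in> Hom D (on_obj F a) (on_obj G a) \<and> \<epsilon> a \<in> Hom D (on_obj G a) (on_obj F a) \<and>
           \<epsilon> a \<cdot>\<^bsub>D\<^esub> \<eta> a = Id D (on_obj F a) \<and> \<eta> a \<cdot>\<^bsub>D\<^esub> \<epsilon> a = Id D (on_obj G a)) \<and>
        (\<forall>f\<in>Arr C. on_arr G f \<cdot>\<^bsub>D\<^esub> \<eta> (Dom C f) = \<eta> (Cod C f) \<cdot>\<^bsub>D\<^esub> on_arr F f))"

definition adjoint ::
  "('o1, 'm1) cat \<Rightarrow> ('o2, 'm2) cat \<Rightarrow> ('o1, 'm1, 'o2, 'm2) functor_data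
     \<Rightarrow> ('o2, 'm2, 'o1, 'm1) functor_data \<Rightarrow> bool" where
  "adjoint C D F G \<longleftrightarrow> is_functor C D F \<and> is_functor D C G \<and>
     (\<exists>\<theta>.
        (\<forall>a\<in>Obj C. \<forall>b\<in>Obj D. bij_betw (\<theta> a b) (Hom D (on_obj F a) b) (Hom C a (on_obj G b))) \<and>
        (\<forall>a\<in>Obj C. \<forall>a'\<in>Obj C. \<forall>b\<in>Obj D. \<forall>b'\<in>Obj D.
           \<forall>f\<in>Hom C a' a. \<forall>g\<in>Hom D b b'. \<forall>h\<in>Hom D (on_obj F a) b.
             \<theta> a' b' (g \<cdot>\<^bsub>D\<^esub> h \<cdot>\<^bsub>D\<^esub> on_arr F f) = on_arr G g \<cdot>\<^bsub>C\<^esub> \<theta> a b h \<cdot>\<^bsub>C\<^esub> f))"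

definition cone ::
  "('j, 'k) cat \<Rightarrow> ('o, 'm) cat \<Rightarrow> ('j, 'k, 'o, 'm) functor_data \<Rightarrow> 'o \<Rightarrow> ('j \<Rightarrow> 'm) \<Rightarrow> bool" where
  "cone J C D c \<tau> \<longleftrightarrow> c \<in> Obj C \<and>
     (\<forall>j\<in>Obj J. \<tau> j \<in> Hom C c (on_obj D j)) \<and>
     (\<forall>k\<in>Arr J. on_arr D k \<cdot>\<^bsub>C\<^esub> \<tau> (Dom J k) = \<tau> (Cod J k))"

definition limit_cone ::
  "('j, 'k) cat \<Rightarrow> ('o, 'm) cat \<Rightarrow> ('j, 'k, 'o, 'm) functor_data \<Rightarrow> 'o \<Rightarrow> ('j \<Rightarrow> 'm) \<Rightarrow> bool" where
  "limit_cone J C D c \<tau> \<longleftrightarrow> cone J C D c \<tau> \<and>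
     (\<forall>c' \<tau>'. cone J C D c' \<tau>' \<longrightarrow>
        (\<exists>!h. h \<in> Hom C c' c \<and> (\<forall>j\<in>Obj J. \<tau> j \<cdot>\<^bsub>C\<^esub> h = \<tau>' j)))"

definition cocone ::
  "('j, 'k) cat \<Rightarrow> ('o, 'm) cat \<Rightarrow> ('j, 'k, 'o, 'm) functor_data \<Rightarrow> 'o \<Rightarrow> ('j \<Rightarrow> 'm) \<Rightarrow> bool" where
  "cocone J C D c \<iota> \<longleftrightarrow> c \<in> Obj C \<and>
     (\<forall>j\<in>Obj J. \<iota> j \<in> Hom C (on_obj D j) c) \<and>
     (\<forall>k\<in>Arr J. \<iota> (Cod J k) \<cdot>\<^bsub>C\<^esub> on_arr D k = \<iota> (Dom J k))"

definition colimit_cocone ::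
  "('j, 'k) cat \<Rightarrow> ('o, 'm) cat \<Rightarrow> ('j, 'k, 'o, 'm) functor_data \<Rightarrow> 'o \<Rightarrow> ('j \<Rightarrow> 'm) \<Rightarrow> bool" where
  "colimit_cocone J C D c \<iota> \<longleftrightarrow> cocone J C D c \<iota> \<and>
     (\<forall>c' \<iota>'. cocone J C D c' \<iota>' \<longrightarrow>
        (\<exists>!h. h \<in> Hom C c c' \<and> (\<forall>j\<in>Obj J. h \<cdot>\<^bsub>C\<^esub> \<iota> j = \<iota>' j)))"

text \<open>
  Every finite category is isomorphic to one whose objects and arrows are natural numbers, and
  every \<open>U\<close>-small category to one whose objects and arrows form members of \<open>U\<close>. So fixing
  the types of the index categories loses no diagrams.
\<close>

definition has_finite_limits :: "('o, 'm) cat \<Rightarrow> bool" where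
  "has_finite_limits C \<longleftrightarrow>
     (\<forall>(J :: (nat, nat) cat) D. finite (Obj J) \<longrightarrow> finite (Arr J) \<longrightarrow> is_functor J C D \<longrightarrow>
        (\<exists>c \<tau>. limit_cone J C D c \<tau>))"

definition preserves_finite_limits ::
  "('o1, 'm1) cat \<Rightarrow> ('o2, 'm2) cat \<Rightarrow> ('o1, 'm1, 'o2, 'm2) functor_data \<Rightarrow> bool" where
  "preserves_finite_limits C C' F \<longleftrightarrow>
     (\<forall>(J :: (nat, nat) cat) D c \<tau>.
        finite (Obj J) \<longrightarrow> finite (Arr J) \<longrightarrow> is_functor J C D \<longrightarrow> limit_cone J C D c \<tau> \<longrightarrow>
        limit_cone J C' (functor_comp F D) (on_obj F c) (\<lambda>j. on_arr F (\<tau> j)))"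

definition cocomplete :: "'u set set \<Rightarrow> ('o, 'm) cat \<Rightarrow> bool" where
  "cocomplete U C \<longleftrightarrow>
     (\<forall>(J :: ('u, 'u) cat) D. Obj J \<in> U \<longrightarrow> Arr J \<in> U \<longrightarrow> is_functor J C D \<longrightarrow>
        (\<exists>c \<iota>. colimit_cocone J C D c \<iota>))"

definition locally_small :: "'u set set \<Rightarrow> ('o, 'm) cat \<Rightarrow> bool" where
  "locally_small U C \<longleftrightarrow> (\<forall>a\<in>Obj C. \<forall>b\<in>Obj C. \<exists>S\<in>U. S \<approx> Hom C a b)"

section \<open>Elementary toposes\<close>

definition terminal :: "('o, 'm) cat \<Rightarrow> 'o \<Rightarrow> bool" where
  "terminal C t \<longleftrightarrow> t \<in> Obj C \<and> (\<forall>a\<in>Obj C. \<exists>!f. f \<in> Hom C a t)"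

definition product :: "('o, 'm) cat \<Rightarrow> 'o \<Rightarrow> 'o \<Rightarrow> 'o \<Rightarrow> 'm \<Rightarrow> 'm \<Rightarrow> bool" where
  "product C a b p \<pi>\<^sub>1 \<pi>\<^sub>2 \<longleftrightarrow> p \<in> Obj C \<and> \<pi>\<^sub>1 \<in> Hom C p a \<and> \<pi>\<^sub>2 \<in> Hom C p b \<and>
     (\<forall>c\<in>Obj C. \<forall>f\<in>Hom C c a. \<forall>g\<in>Hom C c b.
        \<exists>!h. h \<in> Hom C c p \<and> \<pi>\<^sub>1 \<cdot>\<^bsub>C\<^esub> h = f \<and> \<pi>\<^sub>2 \<cdot>\<^bsub>C\<^esub> h = g)"

text \<open>Here \<open>ev\<close> is an arrow from \<open>p = e \<times> a\<close> to \<open>b\<close>, and \<open>h\<close> is \<open>g \<times> id\<^sub>a\<close>.\<close>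

definition exponential ::
  "('o, 'm) cat \<Rightarrow> 'o \<Rightarrow> 'o \<Rightarrow> 'o \<Rightarrow> 'o \<Rightarrow> 'm \<Rightarrow> 'm \<Rightarrow> 'm \<Rightarrow> bool" where
  "exponential C a b e p \<pi>\<^sub>1 \<pi>\<^sub>2 ev \<longleftrightarrow> e \<in> Obj C \<and> product C e a p \<pi>\<^sub>1 \<pi>\<^sub>2 \<and> ev \<in> Hom C p b \<and>
     (\<forall>c q \<rho>\<^sub>1 \<rho>\<^sub>2. \<forall>f\<in>Hom C q b. c \<in> Obj C \<longrightarrow> product C c a q \<rho>\<^sub>1 \<rho>\<^sub>2 \<longrightarrow>
        (\<exists>!g. g \<in> Hom C c e \<and>
           (\<exists>h\<in>Hom C q p. \<pi>\<^sub>1 \<cdot>\<^bsub>C\<^esub> h = g \<cdot>\<^bsub>C\<^esub> \<rho>\<^sub>1 \<and> \<pi>\<^sub>2 \<cdot>\<^bsub>C\<^esub> h = \<rho>\<^sub>2 \<and> ev \<cdot>\<^bsub>C\<^esub> h = f)))"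

definition cartesian_closed :: "('o, 'm) cat \<Rightarrow> bool" where
  "cartesian_closed C \<longleftrightarrow>
     (\<exists>t. terminal C t) \<and>
     (\<forall>a\<in>Obj C. \<forall>b\<in>Obj C. \<exists>p \<pi>\<^sub>1 \<pi>\<^sub>2. product C a b p \<pi>\<^sub>1 \<pi>\<^sub>2) \<and>
     (\<forall>a\<in>Obj C. \<forall>b\<in>Obj C. \<exists>e p \<pi>\<^sub>1 \<pi>\<^sub>2 ev. exponential C a b e p \<pi>\<^sub>1 \<pi>\<^sub>2 ev)"

text \<open>\<open>f \<cdot> p = g \<cdot> q\<close> is a pullback square for the cospan \<open>(f, g)\<close>.\<close>

definition pullback :: "('o, 'm) cat \<Rightarrow> 'm \<Rightarrow> 'm \<Rightarrow> 'm \<Rightarrow> 'm \<Rightarrow> bool" where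
  "pullback C f g p q \<longleftrightarrow>
     f \<in> Arr C \<and> g \<in> Arr C \<and> p \<in> Arr C \<and> q \<in> Arr C \<and> Cod C f = Cod C g \<and> Dom C p = Dom C q \<and>
     Cod C p = Dom C f \<and> Cod C q = Dom C g \<and> f \<cdot>\<^bsub>C\<^esub> p = g \<cdot>\<^bsub>C\<^esub> q \<and>
     (\<forall>c\<in>Obj C. \<forall>x\<in>Hom C c (Dom C f). \<forall>y\<in>Hom C c (Dom C g). f \<cdot>\<^bsub>C\<^esub> x = g \<cdot>\<^bsub>C\<^esub> y \<longrightarrow>
        (\<exists>!h. h \<in> Hom C c (Dom C p) \<and> p \<cdot>\<^bsub>C\<^esub> h = x \<and> q \<cdot>\<^bsub>C\<^esub> h = y))"

definition subobject_classifier :: "('o, 'm) cat \<Rightarrow> 'o \<Rightarrow> 'm \<Rightarrow> bool" where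
  "subobject_classifier C \<Omega> tr \<longleftrightarrow> \<Omega> \<in> Obj C \<and> tr \<in> Arr C \<and> terminal C (Dom C tr) \<and> Cod C tr = \<Omega> \<and>
     (\<forall>m. monic C m \<longrightarrow>
        (\<exists>!\<chi>. \<chi> \<in> Hom C (Cod C m) \<Omega> \<and> (\<exists>k\<in>Hom C (Dom C m) (Dom C tr). pullback C \<chi> tr m k)))"

definition elementary_topos :: "('o, 'm) cat \<Rightarrow> bool" where
  "elementary_topos C \<longleftrightarrow>
     category C \<and> has_finite_limits C \<and> cartesian_closed C \<and> (\<exists>\<Omega> tr. subobject_classifier C \<Omega> tr)"

section \<open>The category of sets and points\<close>

text \<open>A map of sets is a domain, an extensional function and a codomain.\<close>

definition Set_cat :: "'u set set \<Rightarrow> ('u set, 'u set \<times> ('u \<Rightarrow> 'u) \<times> 'u set) cat" where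
  "Set_cat U =
     \<lparr>Obj = U,
      Arr = {(A, f, B). A \<in> U \<and> B \<in> U \<and> f \<in> A \<rightarrow>\<^sub>E B},
      Dom = (\<lambda>(A, f, B). A),
      Cod = (\<lambda>(A, f, B). B),
      Id = (\<lambda>A. (A, (\<lambda>x\<in>A. x), A)),
      Comp = (\<lambda>(B, g, C) (A, f, B'). (A, compose A g f, C))\<rparr>"

record ('o1, 'm1, 'o2, 'm2) geometric_data =
  inverse_image :: "('o2, 'm2, 'o1, 'm1) functor_data"
  direct_image :: "('o1, 'm1, 'o2, 'm2) functor_data"

text \<open>Geometric morphisms from \<open>F\<close> to \<open>E\<close>.\<close>

definition geometric_morphism ::
  "('o1, 'm1) cat \<Rightarrow> ('o2, 'm2) cat \<Rightarrow> ('o1, 'm1, 'o2, 'm2) geometric_data \<Rightarrow> bool" where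
  "geometric_morphism F E p \<longleftrightarrow>
     adjoint E F (inverse_image p) (direct_image p) \<and>
     preserves_finite_limits E F (inverse_image p)"

type_synonym ('u, 'o, 'm) point_data =
  "('u set, 'u set \<times> ('u \<Rightarrow> 'u) \<times> 'u set, 'o, 'm) geometric_data"

definition point :: "'u set set \<Rightarrow> ('o, 'm) cat \<Rightarrow> ('u, 'o, 'm) point_data \<Rightarrow> bool" where
  "point U E p \<longleftrightarrow> geometric_morphism (Set_cat U) E p"

definition points_isomorphic ::
  "'u set set \<Rightarrow> ('o, 'm) cat \<Rightarrow> ('u, 'o, 'm) point_data \<Rightarrow> ('u, 'o, 'm) point_data \<Rightarrow> bool" where
  "points_isomorphic U E p q \<longleftrightarrow>
     naturally_isomorphic E (Set_cat U) (inverse_image p) (inverse_image q)"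

text \<open>
  Points are considered up to isomorphism, so an indexing function has to reach every member
  of \<open>P\<close> up to isomorphism only.
\<close>

definition indexing ::
  "'u set set \<Rightarrow> ('o, 'm) cat \<Rightarrow> 'x set \<Rightarrow> ('u, 'o, 'm) point_data set
     \<Rightarrow> ('x \<Rightarrow> ('u, 'o, 'm) point_data) \<Rightarrow> bool" where
  "indexing U E X P i \<longleftrightarrow>
     (\<forall>x\<in>X. i x \<in> P) \<and> (\<forall>p\<in>P. \<exists>x\<in>X. points_isomorphic U E (i x) p)"

section \<open>Frames\<close>

definition is_frame :: "'a gorder \<Rightarrow> bool" where
  "is_frame L \<longleftrightarrow> complete_lattice L \<and>
     (\<forall>a\<in>carrier L. \<forall>S\<subseteq>carrier L. a \<sqinter>\<^bsub>L\<^esub> (\<Squnion>\<^bsub>L\<^esub> S) = \<Squnion>\<^bsub>L\<^esub> ((\<lambda>s. a \<sqinter>\<^bsub>L\<^esub> s) ` S))"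

definition subframe :: "'a set \<Rightarrow> 'a gorder \<Rightarrow> bool" where
  "subframe \<Gamma> L \<longleftrightarrow> \<Gamma> \<subseteq> carrier L \<and> \<bottom>\<^bsub>L\<^esub> \<in> \<Gamma> \<and> \<top>\<^bsub>L\<^esub> \<in> \<Gamma> \<and>
     (\<forall>S\<subseteq>\<Gamma>. \<Squnion>\<^bsub>L\<^esub> S \<in> \<Gamma>) \<and> (\<forall>a\<in>\<Gamma>. \<forall>b\<in>\<Gamma>. a \<sqinter>\<^bsub>L\<^esub> b \<in> \<Gamma>)"

definition frame_hom :: "'a gorder \<Rightarrow> 'b gorder \<Rightarrow> ('a \<Rightarrow> 'b) \<Rightarrow> bool" where
  "frame_hom L M f \<longleftrightarrow> f \<in> carrier L \<rightarrow> carrier M \<and>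
     (\<forall>S\<subseteq>carrier L. f (\<Squnion>\<^bsub>L\<^esub> S) = \<Squnion>\<^bsub>M\<^esub> (f ` S)) \<and>
     f \<top>\<^bsub>L\<^esub> = \<top>\<^bsub>M\<^esub> \<and>
     (\<forall>a\<in>carrier L. \<forall>b\<in>carrier L. f (a \<sqinter>\<^bsub>L\<^esub> b) = f a \<sqinter>\<^bsub>M\<^esub> f b)"

definition frame_iso :: "'a gorder \<Rightarrow> 'b gorder \<Rightarrow> ('a \<Rightarrow> 'b) \<Rightarrow> bool" where
  "frame_iso L M f \<longleftrightarrow> is_frame L \<and> is_frame M \<and> frame_hom L M f \<and>
     (\<exists>g. frame_hom M L g \<and> (\<forall>a\<in>carrier L. g (f a) = a) \<and> (\<forall>b\<in>carrier M. f (g b) = b))"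

definition opens_frame :: "'x topology \<Rightarrow> 'x set gorder" where
  "opens_frame T = \<lparr>carrier = {S. openin T S}, eq = (=), le = (\<subseteq>)\<rparr>"

section \<open>Subterminal objects\<close>

definition subterminal :: "('o, 'm) cat \<Rightarrow> 'o \<Rightarrow> bool" where
  "subterminal C u \<longleftrightarrow> u \<in> Obj C \<and> (\<exists>t. terminal C t \<and> (\<exists>m\<in>Hom C u t. monic C m))"

definition iso_class :: "('o, 'm) cat \<Rightarrow> 'o \<Rightarrow> 'o set" where
  "iso_class C u = {v \<in> Obj C. isomorphic C u v}"

text \<open>
  The poset of subobjects of the terminal object. Its elements are isomorphism classes of
  subterminal objects. An arrow between subterminal objects automatically commutes with the
  monomorphisms to the terminal object, so the order is the usual order on subobjects.
\<close>

definition Sub_one :: "('o, 'm) cat \<Rightarrow> 'o set gorder" where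
  "Sub_one C =
     \<lparr>carrier = iso_class C ` {u. subterminal C u},
      eq = (=),
      le = (\<lambda>c d. \<exists>u\<in>c. \<exists>v\<in>d. Hom C u v \<noteq> {})\<rparr>"

text \<open>
  The elements of \<open>\<Gamma>\<close> are isomorphism classes, so \<open>\<Union>\<Gamma>\<close> is the collection of the subterminal
  objects that belong to \<open>\<Gamma>\<close>.
\<close>

definition separates_subterminals ::
  "'u set set \<Rightarrow> ('o, 'm) cat \<Rightarrow> ('u, 'o, 'm) point_data set \<Rightarrow> 'o set set \<Rightarrow> bool" where
  "separates_subterminals U E P \<Gamma> \<longleftrightarrow>
     (\<forall>u\<in>\<Union>\<Gamma>. \<forall>v\<in>\<Union>\<Gamma>. \<not> isomorphic E u v \<longrightarrow>
        (\<exists>p\<in>P. \<not> isomorphic (Set_cat U) (on_obj (inverse_image p) u) (on_obj (inverse_image p) v)))"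

definition subterminal_map ::
  "'u set set \<Rightarrow> 'o set set \<Rightarrow> 'x set \<Rightarrow> ('x \<Rightarrow> ('u, 'o, 'm) point_data) \<Rightarrow> 'o set \<Rightarrow> 'x set" where
  "subterminal_map U \<Gamma> X i =
     (\<lambda>c\<in>\<Gamma>. {x \<in> X. \<exists>u\<in>c. \<exists>t. terminal (Set_cat U) t \<and>
                        isomorphic (Set_cat U) (on_obj (inverse_image (i x)) u) t})"

definition subterminal_opens ::
  "'u set set \<Rightarrow> 'o set set \<Rightarrow> 'x set \<Rightarrow> ('x \<Rightarrow> ('u, 'o, 'm) point_data) \<Rightarrow> 'x set set" where
  "subterminal_opens U \<Gamma> X i = subterminal_map U \<Gamma> X i ` \<Gamma>"

text \<open>
  It is a topology on \<open>X\<close>, not merely on a subset of \<open>X\<close>, when the union of its members is \<open>X\<close>.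
\<close>

definition topology_on :: "'x set \<Rightarrow> 'x set set \<Rightarrow> bool" where
  "topology_on X \<tau> \<longleftrightarrow> istopology (\<lambda>S. S \<in> \<tau>) \<and> \<Union>\<tau> = X"

end

theory Submission
  imports Defs
begin

text \<open>
  A point \<open>p\<close> sends a subterminal object \<open>u\<close> to a set with at most one element, so all it
  knows about \<open>u\<close> is whether the stalk \<open>p\<^sup>*u\<close> is empty. By the adjunction,
  \<open>p\<^sup>*u = {}\<close> holds if and only if there is an arrow \<open>u \<rightarrow> p\<^sub>*{}\<close>. The object \<open>p\<^sub>*{}\<close>
  is itself subterminal, and it is a prime element of \<open>Sub(1)\<close> because \<open>p\<^sup>*\<close> preserves the
  terminal object and binary products (\<open>stalk_empty_iff\<close>, \<open>stalk_product_nonempty\<close>). So with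
  \<open>W x = i(x)\<^sub>*{}\<close> the map \<open>\<phi>\<close> is
  \<open>\<phi> c = {x \<in> X. \<not> c \<le> W x}\<close>, the usual map from a frame to the open sets of a family of its
  prime elements.

  The rest of the argument about \<open>\<phi>\<close> is lattice theory (\<open>prime_elements_topology\<close>): \<open>\<phi>\<close>
  preserves arbitrary joins because \<open>\<Squnion>S \<le> W x\<close> means \<open>s \<le> W x\<close> for all \<open>s \<in> S\<close>, and finite
  meets because \<open>W x\<close> is prime. Hence its image is a topology, and as a surjective frame
  homomorphism it is an isomorphism if and only if it is injective. Injectivity on \<open>\<Gamma>\<close> is
  separation of the subterminals in \<open>\<Gamma>\<close>, since two stalks of subterminals are isomorphic if
  and only if both or neither are empty (\<open>separates_iff_inj_on\<close>).

  What remains is that \<open>Sub(1)\<close> is a frame (\<open>Sub_one_frame\<close>). This needs no image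
  factorizations: meets are products, and exponentials of subterminals give the Heyting implication, from
  which the infinite distributive law follows. For the join of a set \<open>S\<close> of subterminals, take the
  colimit of the diagram of all subterminals that lie below some member of \<open>S\<close>. There is only a
  small set of them up to isomorphism, because they are classified by arrows \<open>1 \<rightarrow> \<Omega>\<close> and the topos is locally
  small. Since products with a fixed object preserve jointly epic families in a cartesian closed
  category (\<open>jointly_epic_product\<close>), two arrows into the colimit can be compared on arrows
  that factor through members of the diagram, where they agree because the diagram is closed under
  binary meets. So the colimit is itself subterminal, and it is the join.
\<close>

section \<open>Frames and prime elements\<close>

lemma (in partial_order) sup_eqI:
  assumes "A \<subseteq> carrier L" "s \<in> carrier L" "\<And>x. x \<in> A \<Longrightarrow> x \<sqsubseteq> s"
    and "\<And>y. y \<in> carrier L \<Longrightarrow> (\<And>x. x \<in> A \<Longrightarrow> x \<sqsubseteq> y) \<Longrightarrow> s \<sqsubseteq> y"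
  shows "\<Squnion>A = s"
proof -
  have "least L s (Upper L A)"
    using assms by (intro least_UpperI) (auto simp: Upper_def subset_iff)
  then show ?thesis
    unfolding sup_def by (blast intro: some_equality least_unique)
qed

lemma (in partial_order) meet_eqI:
  assumes "a \<in> carrier L" "b \<in> carrier L" "m \<in> carrier L" "m \<sqsubseteq> a" "m \<sqsubseteq> b"
    and "\<And>y. y \<in> carrier L \<Longrightarrow> y \<sqsubseteq> a \<Longrightarrow> y \<sqsubseteq> b \<Longrightarrow> y \<sqsubseteq> m"
  shows "a \<sqinter> b = m"
proof -
  have "greatest L m (Lower L {a, b})"
    using assms by (intro greatest_LowerI) (auto simp: Lower_def)
  then show ?thesis
    unfolding meet_def inf_def by (blast intro: some_equality greatest_unique)
qed

lemma (in partial_order) top_eqI: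
  assumes "t \<in> carrier L" "\<And>y. y \<in> carrier L \<Longrightarrow> y \<sqsubseteq> t"
  shows "\<top> = t"
proof -
  have "greatest L t (carrier L)"
    using assms by (auto simp: greatest_def)
  then show ?thesis
    unfolding top_def by (blast intro: some_equality greatest_unique)
qed

lemma (in partial_order) complete_lattice_of_sups:
  assumes "\<And>A. A \<subseteq> carrier L \<Longrightarrow> \<exists>s. least L s (Upper L A)"
  shows "complete_lattice L"
proof (rule complete_latticeI)
  fix A assume A: "A \<subseteq> carrier L"
  obtain i where i: "least L i (Upper L (Lower L A))"
    using assms[of "Lower L A"] by auto
  have "greatest L i (Lower L A)"
    using i A by (auto simp: least_def greatest_def Upper_def Lower_def)
  then show "\<exists>i. greatest L i (Lower L A)" ..
qed (rule assms)

text \<open>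
  If \<open>a \<sqinter> _\<close> has a right adjoint then it preserves joins: every upper bound \<open>y\<close> of the elements
  \<open>a \<sqinter> s\<close> turns into the upper bound \<open>a \<Rightarrow> y\<close> of the elements \<open>s\<close>.
\<close>

lemma is_frame_of_implication:
  fixes L (structure)
  assumes "complete_lattice L"
    and imp: "\<And>a w. a \<in> carrier L \<Longrightarrow> w \<in> carrier L \<Longrightarrow>
      \<exists>e\<in>carrier L. \<forall>c\<in>carrier L. c \<sqsubseteq> e \<longleftrightarrow> a \<sqinter> c \<sqsubseteq> w"
  shows "is_frame L"
  unfolding is_frame_def
proof (intro conjI ballI allI impI)
  show "complete_lattice L" by fact
  interpret complete_lattice L by fact
  fix a S assume a: "a \<in> carrier L" and S: "S \<subseteq> carrier L"
  let ?T = "(\<lambda>s. a \<sqinter> s) ` S"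
  have T: "?T \<subseteq> carrier L" using a S by auto
  have "\<Squnion>?T = a \<sqinter> \<Squnion>S"
  proof (rule sup_eqI[OF T])
    show "a \<sqinter> \<Squnion>S \<in> carrier L" using a S by simp
  next
    fix x assume "x \<in> ?T"
    then obtain s where s: "s \<in> S" "x = a \<sqinter> s" by auto
    have "s \<in> carrier L" using S s(1) by auto
    moreover from this have "a \<sqinter> s \<sqsubseteq> \<Squnion>S"
      using a S s(1) by (intro le_trans[OF meet_right sup_upper]) auto
    ultimately show "x \<sqsubseteq> a \<sqinter> \<Squnion>S"
      unfolding s(2) using a S by (intro meet_le) (auto intro: meet_left)
  next
    fix y assume y: "y \<in> carrier L" "\<And>x. x \<in> ?T \<Longrightarrow> x \<sqsubseteq> y"
    obtain e where e: "e \<in> carrier L" "\<And>c. c \<in> carrier L \<Longrightarrow> c \<sqsubseteq> e \<longleftrightarrow> a \<sqinter> c \<sqsubseteq> y"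
      using imp[OF a y(1)] by blast
    have "\<Squnion>S \<sqsubseteq> e" using S e y(2) by (intro sup_least) auto
    then show "a \<sqinter> \<Squnion>S \<sqsubseteq> y" using e(2) S by simp
  qed
  then show "a \<sqinter> \<Squnion>S = \<Squnion>?T" ..
qed

lemma subframe_carrier: "complete_lattice L \<Longrightarrow> subframe (carrier L) L"
  unfolding subframe_def
proof (intro conjI allI impI ballI subset_refl)
  assume "complete_lattice L"
  then interpret complete_lattice L .
  show "\<bottom>\<^bsub>L\<^esub> \<in> carrier L" "\<top>\<^bsub>L\<^esub> \<in> carrier L" by auto
  show "\<Squnion>\<^bsub>L\<^esub>S \<in> carrier L" if "S \<subseteq> carrier L" for S using that by simp
  show "a \<sqinter>\<^bsub>L\<^esub> b \<in> carrier L" if "a \<in> carrier L" "b \<in> carrier L" for a b using that by simp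
qed

lemma (in partial_order) partial_order_subset:
  assumes "A \<subseteq> carrier L"
  shows "partial_order (L\<lparr>carrier := A\<rparr>)"
proof -
  interpret sub: weak_partial_order "L\<lparr>carrier := A\<rparr>"
    using weak_partial_order_subset[OF weak_partial_order_axioms assms] .
  show ?thesis by unfold_locales (simp add: eq_is_equal)
qed

text \<open>
  The operations of the restricted order are again defined by choosing a least upper or greatest
  lower bound. They agree with those of the whole frame because the bounds of the whole frame
  already lie in the subframe.
\<close>

context
  fixes L :: "'a gorder" and \<Gamma>
  assumes L: "is_frame L" and sub: "subframe \<Gamma> L"
begin

interpretation complete_lattice L
  using L by (simp add: is_frame_def)

interpretation sub: partial_order "L\<lparr>carrier := \<Gamma>\<rparr>"
  using sub by (intro partial_order_subset) (simp add: subframe_def)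

lemma subframe_sup: "S \<subseteq> \<Gamma> \<Longrightarrow> \<Squnion>\<^bsub>L\<lparr>carrier := \<Gamma>\<rparr>\<^esub> S = \<Squnion>\<^bsub>L\<^esub> S"
  using sub by (intro sub.sup_eqI) (auto simp: subframe_def subset_iff intro: sup_upper intro!: sup_least)

lemma subframe_meet: "a \<in> \<Gamma> \<Longrightarrow> b \<in> \<Gamma> \<Longrightarrow> a \<sqinter>\<^bsub>L\<lparr>carrier := \<Gamma>\<rparr>\<^esub> b = a \<sqinter>\<^bsub>L\<^esub> b"
  using sub by (intro sub.meet_eqI) (auto simp: subframe_def intro: meet_left meet_right meet_le)

lemma subframe_top: "\<top>\<^bsub>L\<lparr>carrier := \<Gamma>\<rparr>\<^esub> = \<top>\<^bsub>L\<^esub>"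
  using sub by (intro sub.top_eqI) (auto simp: subframe_def)

lemma is_frame_subframe: "is_frame (L\<lparr>carrier := \<Gamma>\<rparr>)"
  unfolding is_frame_def
proof (intro conjI ballI allI impI)
  have "\<exists>s. least (L\<lparr>carrier := \<Gamma>\<rparr>) s (Upper (L\<lparr>carrier := \<Gamma>\<rparr>) A)" if "A \<subseteq> \<Gamma>" for A
  proof
    show "least (L\<lparr>carrier := \<Gamma>\<rparr>) (\<Squnion>\<^bsub>L\<^esub> A) (Upper (L\<lparr>carrier := \<Gamma>\<rparr>) A)"
      using sub that by (intro least_UpperI) (auto simp: subframe_def Upper_def subset_iff intro: sup_upper intro!: sup_least)
  qed
  then show "complete_lattice (L\<lparr>carrier := \<Gamma>\<rparr>)"
    by (intro sub.complete_lattice_of_sups) simp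
next
  fix a S assume "a \<in> carrier (L\<lparr>carrier := \<Gamma>\<rparr>)" "S \<subseteq> carrier (L\<lparr>carrier := \<Gamma>\<rparr>)"
  then have aS: "a \<in> \<Gamma>" "S \<subseteq> \<Gamma>" by auto
  then have "\<Squnion>\<^bsub>L\<^esub> S \<in> \<Gamma>" "(\<lambda>s. a \<sqinter>\<^bsub>L\<^esub> s) ` S \<subseteq> \<Gamma>" "a \<in> carrier L" "S \<subseteq> carrier L"
    using sub by (auto simp: subframe_def)
  moreover have "(\<lambda>s. a \<sqinter>\<^bsub>L\<lparr>carrier := \<Gamma>\<rparr>\<^esub> s) ` S = (\<lambda>s. a \<sqinter>\<^bsub>L\<^esub> s) ` S"
    using aS by (intro image_cong refl subframe_meet) auto
  ultimately show "a \<sqinter>\<^bsub>L\<lparr>carrier := \<Gamma>\<rparr>\<^esub> (\<Squnion>\<^bsub>L\<lparr>carrier := \<Gamma>\<rparr>\<^esub> S) =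
      \<Squnion>\<^bsub>L\<lparr>carrier := \<Gamma>\<rparr>\<^esub> ((\<lambda>s. a \<sqinter>\<^bsub>L\<lparr>carrier := \<Gamma>\<rparr>\<^esub> s) ` S)"
    using aS L by (simp add: subframe_sup subframe_meet is_frame_def)
qed

end

context
  fixes T :: "'x topology"
begin

interpretation opens: partial_order "opens_frame T"
  by unfold_locales (auto simp: opens_frame_def)

lemma opens_frame_sup: "S \<subseteq> {A. openin T A} \<Longrightarrow> \<Squnion>\<^bsub>opens_frame T\<^esub> S = \<Union>S"
  by (intro opens.sup_eqI) (auto simp: opens_frame_def)

lemma opens_frame_meet: "openin T A \<Longrightarrow> openin T B \<Longrightarrow> A \<sqinter>\<^bsub>opens_frame T\<^esub> B = A \<inter> B"
  by (intro opens.meet_eqI) (auto simp: opens_frame_def)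

lemma opens_frame_top: "\<top>\<^bsub>opens_frame T\<^esub> = topspace T"
  by (intro opens.top_eqI) (auto simp: opens_frame_def openin_subset)

lemma is_frame_opens_frame: "is_frame (opens_frame T)"
  unfolding is_frame_def
proof (intro conjI ballI allI impI)
  have "\<exists>s. least (opens_frame T) s (Upper (opens_frame T) \<A>)"
    if "\<A> \<subseteq> carrier (opens_frame T)" for \<A>
  proof
    show "least (opens_frame T) (\<Union>\<A>) (Upper (opens_frame T) \<A>)"
      using that by (intro least_UpperI) (auto simp: opens_frame_def Upper_def)
  qed
  then show "complete_lattice (opens_frame T)"
    by (rule opens.complete_lattice_of_sups)
next
  fix A S assume "A \<in> carrier (opens_frame T)" "S \<subseteq> carrier (opens_frame T)"
  then have A: "openin T A" and S: "S \<subseteq> {B. openin T B}"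
    by (auto simp: opens_frame_def)
  then have "(\<lambda>B. A \<sqinter>\<^bsub>opens_frame T\<^esub> B) ` S = (\<lambda>B. A \<inter> B) ` S"
    by (intro image_cong refl opens_frame_meet) auto
  moreover have "openin T (\<Union>S)" "(\<lambda>B. A \<inter> B) ` S \<subseteq> {B. openin T B}"
    using A S by auto
  ultimately show "A \<sqinter>\<^bsub>opens_frame T\<^esub> (\<Squnion>\<^bsub>opens_frame T\<^esub> S) =
      \<Squnion>\<^bsub>opens_frame T\<^esub> ((\<lambda>B. A \<sqinter>\<^bsub>opens_frame T\<^esub> B) ` S)"
    using A S by (auto simp: opens_frame_sup opens_frame_meet)
qed

end

lemma frame_iso_iff_bij_betw:
  assumes "is_frame L" "is_frame M" and f: "frame_hom L M f"
  shows "frame_iso L M f \<longleftrightarrow> bij_betw f (carrier L) (carrier M)"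
proof
  assume "frame_iso L M f"
  then obtain g where g: "frame_hom M L g" "\<forall>a\<in>carrier L. g (f a) = a" "\<forall>b\<in>carrier M. f (g b) = b"
    unfolding frame_iso_def by blast
  show "bij_betw f (carrier L) (carrier M)"
    using f g by (intro bij_betw_byWitness[where f' = g]) (auto simp: frame_hom_def)
next
  assume bij: "bij_betw f (carrier L) (carrier M)"
  interpret L: complete_lattice L using assms by (simp add: is_frame_def)
  define g where "g = inv_into (carrier L) f"
  have fg: "f (g b) = b" "g b \<in> carrier L" if "b \<in> carrier M" for b
    using bij that by (auto simp: g_def bij_betw_def f_inv_into_f inv_into_into)
  have gf: "g (f a) = a" if "a \<in> carrier L" for a
    using bij that by (simp add: g_def bij_betw_def)
  have "frame_hom M L g"
    unfolding frame_hom_def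
  proof (intro conjI ballI allI impI)
    show "g \<in> carrier M \<rightarrow> carrier L" using fg by auto
  next
    fix S assume S: "S \<subseteq> carrier M"
    then have "f ` g ` S = (\<lambda>b. b) ` S"
      unfolding image_image using fg by (intro image_cong) auto
    moreover have gS: "g ` S \<subseteq> carrier L" using S fg by auto
    ultimately have "f (\<Squnion>\<^bsub>L\<^esub> (g ` S)) = \<Squnion>\<^bsub>M\<^esub> S"
      using f by (simp add: frame_hom_def)
    then show "g (\<Squnion>\<^bsub>M\<^esub> S) = \<Squnion>\<^bsub>L\<^esub> (g ` S)"
      using gf gS by (metis L.sup_closed)
  next
    show "g \<top>\<^bsub>M\<^esub> = \<top>\<^bsub>L\<^esub>" using f gf by (metis L.top_closed frame_hom_def)
  next
    fix a b assume ab: "a \<in> carrier M" "b \<in> carrier M"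
    then have "f (g a \<sqinter>\<^bsub>L\<^esub> g b) = a \<sqinter>\<^bsub>M\<^esub> b"
      using f fg by (simp add: frame_hom_def)
    then show "g (a \<sqinter>\<^bsub>M\<^esub> b) = g a \<sqinter>\<^bsub>L\<^esub> g b"
      using gf fg ab by (metis L.meet_closed)
  qed
  with assms fg gf show "frame_iso L M f"
    unfolding frame_iso_def by blast
qed

text \<open>
  A prime element \<open>w\<close> of a frame is the same thing as a frame homomorphism to the two-element
  frame, namely \<open>c \<mapsto> (\<not> c \<le> w)\<close>. The map \<open>\<phi>\<close> collects these homomorphisms for a family of
  primes, so it is a frame homomorphism to the power set of \<open>X\<close>; everything claimed follows from
  this together with the fact that \<open>\<phi>\<close> is onto its image.
\<close>

theorem prime_elements_topology:
  fixes L :: "'a gorder"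
  assumes L: "is_frame L" and sub: "subframe \<Gamma> L"
    and W: "\<And>x. x \<in> X \<Longrightarrow> W x \<in> carrier L"
    and top: "\<And>x. x \<in> X \<Longrightarrow> \<not> \<top>\<^bsub>L\<^esub> \<sqsubseteq>\<^bsub>L\<^esub> W x"
    and prime: "\<And>x a b. x \<in> X \<Longrightarrow> a \<in> carrier L \<Longrightarrow> b \<in> carrier L \<Longrightarrow>
      a \<sqinter>\<^bsub>L\<^esub> b \<sqsubseteq>\<^bsub>L\<^esub> W x \<Longrightarrow> a \<sqsubseteq>\<^bsub>L\<^esub> W x \<or> b \<sqsubseteq>\<^bsub>L\<^esub> W x"
    and \<phi>: "\<And>c. c \<in> \<Gamma> \<Longrightarrow> \<phi> c = {x \<in> X. \<not> c \<sqsubseteq>\<^bsub>L\<^esub> W x}"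
  shows "topology_on X (\<phi> ` \<Gamma>)"
    and "frame_iso (L\<lparr>carrier := \<Gamma>\<rparr>) (opens_frame (topology (\<lambda>S. S \<in> \<phi> ` \<Gamma>))) \<phi> \<longleftrightarrow> inj_on \<phi> \<Gamma>"
proof -
  interpret complete_lattice L using L by (simp add: is_frame_def)
  have \<Gamma>: "\<Gamma> \<subseteq> carrier L" "\<And>S. S \<subseteq> \<Gamma> \<Longrightarrow> \<Squnion>\<^bsub>L\<^esub> S \<in> \<Gamma>" "\<top>\<^bsub>L\<^esub> \<in> \<Gamma>"
      "\<And>a b. a \<in> \<Gamma> \<Longrightarrow> b \<in> \<Gamma> \<Longrightarrow> a \<sqinter>\<^bsub>L\<^esub> b \<in> \<Gamma>"
    using sub by (auto simp: subframe_def)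
  have \<phi>_sup: "\<phi> (\<Squnion>\<^bsub>L\<^esub> S) = \<Union>(\<phi> ` S)" if S: "S \<subseteq> \<Gamma>" for S
  proof -
    have "S \<subseteq> carrier L" using S \<Gamma>(1) by simp
    then have *: "\<Squnion>\<^bsub>L\<^esub> S \<sqsubseteq>\<^bsub>L\<^esub> W x \<longleftrightarrow> (\<forall>s\<in>S. s \<sqsubseteq>\<^bsub>L\<^esub> W x)" if "x \<in> X" for x
      using W[OF that] by (meson le_trans sup_closed sup_least sup_upper subsetD)
    have "(\<Union>s\<in>S. \<phi> s) = (\<Union>s\<in>S. {x \<in> X. \<not> s \<sqsubseteq>\<^bsub>L\<^esub> W x})"
      using S by (intro SUP_cong refl \<phi>) auto
    with * show ?thesis using \<phi>[OF \<Gamma>(2)[OF S]] by auto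
  qed
  have \<phi>_meet: "\<phi> (a \<sqinter>\<^bsub>L\<^esub> b) = \<phi> a \<inter> \<phi> b" if ab: "a \<in> \<Gamma>" "b \<in> \<Gamma>" for a b
  proof -
    have "a \<in> carrier L" "b \<in> carrier L" using ab \<Gamma>(1) by auto
    then have "a \<sqinter>\<^bsub>L\<^esub> b \<sqsubseteq>\<^bsub>L\<^esub> W x \<longleftrightarrow> a \<sqsubseteq>\<^bsub>L\<^esub> W x \<or> b \<sqsubseteq>\<^bsub>L\<^esub> W x" if "x \<in> X" for x
      using W[OF that] prime[OF that] by (meson le_trans meet_closed meet_left meet_right)
    then show ?thesis using ab \<Gamma>(4) by (auto simp: \<phi>)
  qed
  have \<phi>_top: "\<phi> \<top>\<^bsub>L\<^esub> = X" using \<Gamma>(3) top by (auto simp: \<phi>)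
  have ist: "istopology (\<lambda>S. S \<in> \<phi> ` \<Gamma>)"
    unfolding istopology_def
  proof (intro conjI allI impI)
    fix A B assume "A \<in> \<phi> ` \<Gamma>" "B \<in> \<phi> ` \<Gamma>"
    then show "A \<inter> B \<in> \<phi> ` \<Gamma>" using \<phi>_meet \<Gamma>(4) by (auto simp flip: \<phi>_meet)
  next
    fix \<K> assume "\<forall>K\<in>\<K>. K \<in> \<phi> ` \<Gamma>"
    then obtain S where "S \<subseteq> \<Gamma>" "\<K> = \<phi> ` S"
      by (metis subsetI subset_imageE)
    then show "\<Union>\<K> \<in> \<phi> ` \<Gamma>" using \<phi>_sup \<Gamma>(2) by (metis imageI)
  qed
  have Un: "\<Union>(\<phi> ` \<Gamma>) = X"
    using \<phi>_top \<Gamma>(3) \<phi> by blast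
  with ist show "topology_on X (\<phi> ` \<Gamma>)" by (simp add: topology_on_def)
  define T where "T = topology (\<lambda>S. S \<in> \<phi> ` \<Gamma>)"
  have openin_T: "openin T A \<longleftrightarrow> A \<in> \<phi> ` \<Gamma>" for A
    using ist by (simp add: T_def)
  have "topspace T = X" using Un by (simp add: topspace_def openin_T)
  have "frame_hom (L\<lparr>carrier := \<Gamma>\<rparr>) (opens_frame T) \<phi>"
    unfolding frame_hom_def
  proof (intro conjI ballI allI impI)
    show "\<phi> \<in> carrier (L\<lparr>carrier := \<Gamma>\<rparr>) \<rightarrow> carrier (opens_frame T)"
      by (auto simp: opens_frame_def openin_T)
    show "\<phi> \<top>\<^bsub>L\<lparr>carrier := \<Gamma>\<rparr>\<^esub> = \<top>\<^bsub>opens_frame T\<^esub>"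
      using \<phi>_top \<open>topspace T = X\<close> by (simp add: subframe_top[OF L sub] opens_frame_top)
  next
    fix S assume "S \<subseteq> carrier (L\<lparr>carrier := \<Gamma>\<rparr>)"
    then show "\<phi> (\<Squnion>\<^bsub>L\<lparr>carrier := \<Gamma>\<rparr>\<^esub> S) = \<Squnion>\<^bsub>opens_frame T\<^esub> (\<phi> ` S)"
      by (subst opens_frame_sup) (auto simp: subframe_sup[OF L sub] \<phi>_sup openin_T)
  next
    fix a b assume "a \<in> carrier (L\<lparr>carrier := \<Gamma>\<rparr>)" "b \<in> carrier (L\<lparr>carrier := \<Gamma>\<rparr>)"
    then show "\<phi> (a \<sqinter>\<^bsub>L\<lparr>carrier := \<Gamma>\<rparr>\<^esub> b) = \<phi> a \<sqinter>\<^bsub>opens_frame T\<^esub> \<phi> b"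
      by (simp add: subframe_meet[OF L sub] opens_frame_meet openin_T \<phi>_meet)
  qed
  then have "frame_iso (L\<lparr>carrier := \<Gamma>\<rparr>) (opens_frame T) \<phi> \<longleftrightarrow>
      bij_betw \<phi> (carrier (L\<lparr>carrier := \<Gamma>\<rparr>)) (carrier (opens_frame T))"
    by (intro frame_iso_iff_bij_betw is_frame_subframe[OF L sub] is_frame_opens_frame)
  also have "\<dots> \<longleftrightarrow> inj_on \<phi> \<Gamma>"
    by (auto simp: bij_betw_def opens_frame_def openin_T)
  finally show "frame_iso (L\<lparr>carrier := \<Gamma>\<rparr>) (opens_frame (topology (\<lambda>S. S \<in> \<phi> ` \<Gamma>))) \<phi> \<longleftrightarrow> inj_on \<phi> \<Gamma>"
    by (simp add: T_def)
qed

section \<open>Universes\<close>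

lemma universe_subset: "universe U \<Longrightarrow> A \<in> U \<Longrightarrow> B \<subseteq> A \<Longrightarrow> B \<in> U"
  unfolding universe_def using subset_imp_lepoll by blast

lemma universe_empty: "universe U \<Longrightarrow> {} \<in> U"
  using universe_subset[of U _ "{}"] unfolding universe_def by blast

lemma universe_singleton:
  fixes U :: "'u set set"
  assumes "universe U"
  shows "{z} \<in> U"
proof -
  obtain B where B: "B \<in> U" "B \<approx> Pow ({} :: 'u set)"
    using assms universe_empty[OF assms] unfolding universe_def by blast
  have "{z} \<lesssim> B"
    using B(2) by (metis Pow_empty eqpoll_sym eqpoll_trans eqpoll_imp_lepoll singleton_eqpoll)
  then show ?thesis using assms B(1) unfolding universe_def by blast
qed

text \<open>
  Kuratowski pairs give an injection of \<open>A \<times> A\<close> into the double power set of \<open>A\<close>. It is used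
  to encode the arrows of a preorder on \<open>A\<close> as elements of a small set.
\<close>

lemma universe_pairing:
  fixes U :: "'u set set"
  assumes U: "universe U" and A: "A \<in> U"
  obtains q :: "'u \<times> 'u \<Rightarrow> 'u" where "inj_on q (A \<times> A)" "q ` (A \<times> A) \<in> U"
proof -
  obtain B where B: "B \<in> U" "B \<approx> Pow A" using U A unfolding universe_def by blast
  obtain B' where B': "B' \<in> U" "B' \<approx> Pow B" using U B(1) unfolding universe_def by blast
  obtain f where f: "bij_betw f (Pow A) B" using eqpoll_sym[OF B(2)] by (auto simp: eqpoll_def)
  obtain g where g: "bij_betw g (Pow B) B'" using eqpoll_sym[OF B'(2)] by (auto simp: eqpoll_def)
  define q where "q = (\<lambda>(a, b). g {f {a}, f {a, b}})"
  have f_eq: "f X = f Y \<longleftrightarrow> X = Y" if "X \<subseteq> A" "Y \<subseteq> A" for X Y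
    using f that by (auto simp: bij_betw_def inj_on_def)
  have f_in: "f X \<in> B" if "X \<subseteq> A" for X
    using f that by (auto simp: bij_betw_def)
  have g_eq: "g X = g Y \<longleftrightarrow> X = Y" if "X \<subseteq> B" "Y \<subseteq> B" for X Y
    using g that by (auto simp: bij_betw_def inj_on_def)
  have "inj_on q (A \<times> A)"
  proof (rule inj_onI, clarify)
    fix a b a' b' assume A: "a \<in> A" "b \<in> A" "a' \<in> A" "b' \<in> A" and "q (a, b) = q (a', b')"
    then have "g {f {a}, f {a, b}} = g {f {a'}, f {a', b'}}" by (simp add: q_def)
    then have "{f {a}, f {a, b}} = {f {a'}, f {a', b'}}"
      using A g_eq f_in by simp
    then have "{a} = {a'} \<and> {a, b} = {a', b'} \<or> {a} = {a', b'} \<and> {a, b} = {a'}"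
      using A f_eq by (simp add: doubleton_eq_iff)
    then show "a = a' \<and> b = b'" by (auto simp: doubleton_eq_iff)
  qed
  moreover have "q ` (A \<times> A) \<subseteq> B'"
    using g f_in by (auto simp: q_def bij_betw_def)
  ultimately show thesis using that universe_subset[OF U B'(1)] by blast
qed

section \<open>Thin objects\<close>

text \<open>
  In a category with a terminal object these are the subterminal objects
  (\<open>subterminal_iff_thin_object\<close>). This form of the notion mentions no terminal object, and it
  makes sense for the stalks in the category of sets as well.
\<close>

definition thin_object :: "('o, 'm) cat \<Rightarrow> 'o \<Rightarrow> bool" where
  "thin_object C u \<longleftrightarrow> u \<in> Obj C \<and> (\<forall>c. \<forall>f\<in>Hom C c u. \<forall>g\<in>Hom C c u. f = g)"

definition jointly_epic :: "('o, 'm) cat \<Rightarrow> 'm set \<Rightarrow> 'o \<Rightarrow> bool" where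
  "jointly_epic C K a \<longleftrightarrow>
     (\<forall>b. \<forall>f\<in>Hom C a b. \<forall>g\<in>Hom C a b. (\<forall>k\<in>K. f \<cdot>\<^bsub>C\<^esub> k = g \<cdot>\<^bsub>C\<^esub> k) \<longrightarrow> f = g)"

lemma thin_objectD: "thin_object C u \<Longrightarrow> f \<in> Hom C c u \<Longrightarrow> g \<in> Hom C c u \<Longrightarrow> f = g"
  by (auto simp: thin_object_def)

lemma product_commute: "product C a b p \<pi>\<^sub>1 \<pi>\<^sub>2 \<Longrightarrow> product C b a p \<pi>\<^sub>2 \<pi>\<^sub>1"
  unfolding product_def by (metis (no_types, lifting))

lemma product_proj:
  assumes "product C a b p \<pi>\<^sub>1 \<pi>\<^sub>2"
  shows "\<pi>\<^sub>1 \<in> Hom C p a" "\<pi>\<^sub>2 \<in> Hom C p b"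
  using assms by (simp_all add: product_def)

context
  fixes C :: "('o, 'm) cat" (structure)
  assumes C: "category C"
begin

lemma Hom_Obj: "f \<in> Hom C a b \<Longrightarrow> a \<in> Obj C" "f \<in> Hom C a b \<Longrightarrow> b \<in> Obj C"
  using C by (auto simp: category_def Hom_def)

lemma Id_Hom: "a \<in> Obj C \<Longrightarrow> Id C a \<in> Hom C a a"
  using C by (auto simp: category_def)

lemma Id_left: "f \<in> Hom C a b \<Longrightarrow> Id C b \<cdot> f = f"
  using C by (auto simp: category_def Hom_def)

lemma comp_Hom: "f \<in> Hom C a b \<Longrightarrow> g \<in> Hom C b c \<Longrightarrow> g \<cdot> f \<in> Hom C a c"
  using C by (auto simp: category_def Hom_def)

lemma comp_assoc:
  "f \<in> Hom C a b \<Longrightarrow> g \<in> Hom C b c \<Longrightarrow> h \<in> Hom C c d \<Longrightarrow> (h \<cdot> g) \<cdot> f = h \<cdot> (g \<cdot> f)"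
  using C by (auto simp: category_def Hom_def)

lemma Hom_trans: "Hom C a b \<noteq> {} \<Longrightarrow> Hom C b c \<noteq> {} \<Longrightarrow> Hom C a c \<noteq> {}"
  using comp_Hom by blast

lemma product_pair:
  assumes "product C a b p \<pi>\<^sub>1 \<pi>\<^sub>2" and f: "f \<in> Hom C c a" and "g \<in> Hom C c b"
  obtains h where "h \<in> Hom C c p" "\<pi>\<^sub>1 \<cdot> h = f" "\<pi>\<^sub>2 \<cdot> h = g"
  using assms Hom_Obj(1)[OF f] unfolding product_def by metis

lemma product_eqI:
  assumes p: "product C a b p \<pi>\<^sub>1 \<pi>\<^sub>2" and h: "h \<in> Hom C c p" "h' \<in> Hom C c p"
    and "\<pi>\<^sub>1 \<cdot> h = \<pi>\<^sub>1 \<cdot> h'" "\<pi>\<^sub>2 \<cdot> h = \<pi>\<^sub>2 \<cdot> h'"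
  shows "h = h'"
proof -
  have "\<pi>\<^sub>1 \<cdot> h' \<in> Hom C c a" "\<pi>\<^sub>2 \<cdot> h' \<in> Hom C c b"
    using product_proj[OF p] h comp_Hom by blast+
  then have "\<exists>!h. h \<in> Hom C c p \<and> \<pi>\<^sub>1 \<cdot> h = \<pi>\<^sub>1 \<cdot> h' \<and> \<pi>\<^sub>2 \<cdot> h = \<pi>\<^sub>2 \<cdot> h'"
    using p Hom_Obj(1)[OF h(1)] unfolding product_def by blast
  then show ?thesis using assms by blast
qed

lemma terminal_thin_object:
  assumes "terminal C t"
  shows "thin_object C t"
  unfolding thin_object_def
proof (intro conjI allI ballI)
  show "t \<in> Obj C" using assms by (simp add: terminal_def)
  fix c f g assume fg: "f \<in> Hom C c t" "g \<in> Hom C c t"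
  then have "\<exists>!f. f \<in> Hom C c t" using assms Hom_Obj(1) by (simp add: terminal_def)
  then show "f = g" using fg by blast
qed

lemma subterminal_iff_thin_object:
  assumes t: "terminal C t"
  shows "subterminal C u \<longleftrightarrow> thin_object C u"
proof
  assume "subterminal C u"
  then obtain t' m where u: "u \<in> Obj C" and t': "terminal C t'" and m: "m \<in> Hom C u t'" "monic C m"
    unfolding subterminal_def by blast
  have "f = g" if fg: "f \<in> Hom C c u" "g \<in> Hom C c u" for c f g
  proof -
    have "c \<in> Obj C" using fg Hom_Obj by blast
    moreover from this have "m \<cdot> f = m \<cdot> g"
      using t' comp_Hom[OF fg(1) m(1)] comp_Hom[OF fg(2) m(1)] by (auto simp: terminal_def)
    ultimately show ?thesis using m fg by (auto simp: monic_def Hom_def)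
  qed
  with u show "thin_object C u" by (auto simp: thin_object_def)
next
  assume u: "thin_object C u"
  then obtain m where m: "m \<in> Hom C u t"
    using t by (auto simp: thin_object_def terminal_def)
  then have "monic C m"
    using u by (auto simp: monic_def Hom_def thin_object_def)
  with t u m show "subterminal C u"
    unfolding subterminal_def thin_object_def by blast
qed

lemma isomorphic_thin_object_iff:
  assumes "thin_object C u" "thin_object C v"
  shows "isomorphic C u v \<longleftrightarrow> Hom C u v \<noteq> {} \<and> Hom C v u \<noteq> {}"
proof
  assume "Hom C u v \<noteq> {} \<and> Hom C v u \<noteq> {}"
  then obtain f g where fg: "f \<in> Hom C u v" "g \<in> Hom C v u" by blast
  have "g \<cdot> f = Id C u"
    using thin_objectD[OF assms(1) comp_Hom[OF fg] Id_Hom] fg Hom_Obj by blast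
  moreover have "f \<cdot> g = Id C v"
    using thin_objectD[OF assms(2) comp_Hom[OF fg(2,1)] Id_Hom] fg Hom_Obj by blast
  ultimately show "isomorphic C u v" using fg unfolding isomorphic_def by blast
qed (auto simp: isomorphic_def)

lemma thin_object_isomorphic:
  assumes "thin_object C u" "isomorphic C u v"
  shows "thin_object C v"
proof -
  obtain h k where hk: "h \<in> Hom C u v" "k \<in> Hom C v u" "h \<cdot> k = Id C v"
    using assms(2) unfolding isomorphic_def by blast
  have "f = g" if fg: "f \<in> Hom C c v" "g \<in> Hom C c v" for c f g
  proof -
    have "k \<cdot> f = k \<cdot> g"
      using thin_objectD[OF assms(1) comp_Hom[OF fg(1) hk(2)] comp_Hom[OF fg(2) hk(2)]] .
    then have "(h \<cdot> k) \<cdot> f = (h \<cdot> k) \<cdot> g"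
      using comp_assoc[OF fg(1) hk(2,1)] comp_assoc[OF fg(2) hk(2,1)] by simp
    then show ?thesis using fg hk(3) Id_left by simp
  qed
  then show ?thesis using Hom_Obj(2)[OF hk(1)] by (auto simp: thin_object_def)
qed

text \<open>
  This makes being thin a finite-limit property, so that functors preserving finite limits
  preserve it.
\<close>

lemma thin_object_iff_product_self:
  "thin_object C u \<longleftrightarrow> u \<in> Obj C \<and> product C u u u (Id C u) (Id C u)"
proof
  assume u: "thin_object C u"
  then have "u \<in> Obj C" by (simp add: thin_object_def)
  moreover have "\<exists>!h. h \<in> Hom C c u \<and> Id C u \<cdot> h = f \<and> Id C u \<cdot> h = g"
    if "f \<in> Hom C c u" "g \<in> Hom C c u" for c f g
    using that thin_objectD[OF u that] by (auto simp: Id_left)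
  ultimately show "u \<in> Obj C \<and> product C u u u (Id C u) (Id C u)"
    by (simp add: product_def Id_Hom)
next
  assume u: "u \<in> Obj C \<and> product C u u u (Id C u) (Id C u)"
  have "f = g" if fg: "f \<in> Hom C c u" "g \<in> Hom C c u" for c f g
  proof -
    obtain h where "h \<in> Hom C c u" "Id C u \<cdot> h = f" "Id C u \<cdot> h = g"
      using product_pair[OF conjunct2[OF u] fg] .
    then show ?thesis by simp
  qed
  with u show "thin_object C u" by (auto simp: thin_object_def)
qed

lemma thin_object_product:
  assumes "thin_object C a" "thin_object C b" "product C a b p \<pi>\<^sub>1 \<pi>\<^sub>2"
  shows "thin_object C p"
  unfolding thin_object_def
proof (intro conjI ballI allI)
  show "p \<in> Obj C" using assms by (simp add: product_def)
  fix c f g assume fg: "f \<in> Hom C c p" "g \<in> Hom C c p"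
  have \<pi>: "\<pi>\<^sub>1 \<in> Hom C p a" "\<pi>\<^sub>2 \<in> Hom C p b" using product_proj[OF assms(3)] by auto
  show "f = g"
  proof (rule product_eqI[OF assms(3) fg])
    show "\<pi>\<^sub>1 \<cdot> f = \<pi>\<^sub>1 \<cdot> g"
      using thin_objectD[OF assms(1) comp_Hom[OF fg(1) \<pi>(1)] comp_Hom[OF fg(2) \<pi>(1)]] .
    show "\<pi>\<^sub>2 \<cdot> f = \<pi>\<^sub>2 \<cdot> g"
      using thin_objectD[OF assms(2) comp_Hom[OF fg(1) \<pi>(2)] comp_Hom[OF fg(2) \<pi>(2)]] .
  qed
qed

section \<open>Exponentials\<close>

lemma transpose:
  assumes e: "exponential C a b e p \<pi>\<^sub>1 \<pi>\<^sub>2 ev" and q: "product C c a q \<rho>\<^sub>1 \<rho>\<^sub>2" and c: "c \<in> Obj C"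
    and f: "f \<in> Hom C q b"
  obtains g h where "g \<in> Hom C c e" "h \<in> Hom C q p" "\<pi>\<^sub>1 \<cdot> h = g \<cdot> \<rho>\<^sub>1" "\<pi>\<^sub>2 \<cdot> h = \<rho>\<^sub>2" "ev \<cdot> h = f"
proof -
  have "\<exists>!g. g \<in> Hom C c e \<and> (\<exists>h\<in>Hom C q p. \<pi>\<^sub>1 \<cdot> h = g \<cdot> \<rho>\<^sub>1 \<and> \<pi>\<^sub>2 \<cdot> h = \<rho>\<^sub>2 \<and> ev \<cdot> h = f)"
    using e[unfolded exponential_def, THEN conjunct2, THEN conjunct2, THEN conjunct2, rule_format, OF f c q] .
  then show thesis using that by (elim ex1E conjE bexE)
qed

lemma exponential_arrow_iff:
  assumes e: "exponential C a b e p \<pi>\<^sub>1 \<pi>\<^sub>2 ev" and q: "product C c a q \<rho>\<^sub>1 \<rho>\<^sub>2" and c: "c \<in> Obj C"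
  shows "Hom C c e \<noteq> {} \<longleftrightarrow> Hom C q b \<noteq> {}"
proof
  have p: "product C e a p \<pi>\<^sub>1 \<pi>\<^sub>2" and ev: "ev \<in> Hom C p b"
    using e by (auto simp: exponential_def)
  note \<rho> = product_proj[OF q]
  assume "Hom C c e \<noteq> {}"
  then obtain g where g: "g \<in> Hom C c e" by blast
  obtain h where "h \<in> Hom C q p"
    using product_pair[OF p comp_Hom[OF \<rho>(1) g] \<rho>(2)] .
  then show "Hom C q b \<noteq> {}" using ev comp_Hom by blast
next
  assume "Hom C q b \<noteq> {}"
  then obtain f where "f \<in> Hom C q b" by blast
  from transpose[OF e q c this] show "Hom C c e \<noteq> {}" by blast
qed

lemma transpose_unique:
  assumes e: "exponential C a b e p \<pi>\<^sub>1 \<pi>\<^sub>2 ev" and q: "product C c a q \<rho>\<^sub>1 \<rho>\<^sub>2" and c: "c \<in> Obj C"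
    and g: "g \<in> Hom C c e" "h \<in> Hom C q p" "\<pi>\<^sub>1 \<cdot> h = g \<cdot> \<rho>\<^sub>1" "\<pi>\<^sub>2 \<cdot> h = \<rho>\<^sub>2"
    and g': "g' \<in> Hom C c e" "h' \<in> Hom C q p" "\<pi>\<^sub>1 \<cdot> h' = g' \<cdot> \<rho>\<^sub>1" "\<pi>\<^sub>2 \<cdot> h' = \<rho>\<^sub>2"
    and "ev \<cdot> h = ev \<cdot> h'"
  shows "g = g'"
proof -
  have "ev \<cdot> h \<in> Hom C q b" using e comp_Hom[OF g(2)] by (simp add: exponential_def)
  then have "\<exists>!g. g \<in> Hom C c e \<and> (\<exists>h'\<in>Hom C q p. \<pi>\<^sub>1 \<cdot> h' = g \<cdot> \<rho>\<^sub>1 \<and> \<pi>\<^sub>2 \<cdot> h' = \<rho>\<^sub>2 \<and> ev \<cdot> h' = ev \<cdot> h)"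
    using e[unfolded exponential_def, THEN conjunct2, THEN conjunct2, THEN conjunct2, rule_format]
      c q by blast
  then show ?thesis using g g' \<open>ev \<cdot> h = ev \<cdot> h'\<close> by metis
qed

text \<open>
  Arrows into an exponential are determined by their transposes, and any two parallel arrows into
  \<open>b\<close> are equal.
\<close>

lemma thin_object_exponential:
  assumes cc: "cartesian_closed C" and e: "exponential C a b e p \<pi>\<^sub>1 \<pi>\<^sub>2 ev"
    and a: "a \<in> Obj C" and b: "thin_object C b"
  shows "thin_object C e"
  unfolding thin_object_def
proof (intro conjI ballI allI)
  show "e \<in> Obj C" using e by (simp add: exponential_def)
  have p: "product C e a p \<pi>\<^sub>1 \<pi>\<^sub>2" and ev: "ev \<in> Hom C p b"
    using e by (auto simp: exponential_def)
  fix c g g' assume g: "g \<in> Hom C c e" "g' \<in> Hom C c e"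
  then have c: "c \<in> Obj C" using Hom_Obj by blast
  obtain q \<rho>\<^sub>1 \<rho>\<^sub>2 where q: "product C c a q \<rho>\<^sub>1 \<rho>\<^sub>2"
    using cc c a unfolding cartesian_closed_def by blast
  note \<rho> = product_proj[OF q]
  obtain h where h: "h \<in> Hom C q p" "\<pi>\<^sub>1 \<cdot> h = g \<cdot> \<rho>\<^sub>1" "\<pi>\<^sub>2 \<cdot> h = \<rho>\<^sub>2"
    using product_pair[OF p comp_Hom[OF \<rho>(1) g(1)] \<rho>(2)] .
  obtain h' where h': "h' \<in> Hom C q p" "\<pi>\<^sub>1 \<cdot> h' = g' \<cdot> \<rho>\<^sub>1" "\<pi>\<^sub>2 \<cdot> h' = \<rho>\<^sub>2"
    using product_pair[OF p comp_Hom[OF \<rho>(1) g(2)] \<rho>(2)] .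
  have "ev \<cdot> h = ev \<cdot> h'"
    using thin_objectD[OF b comp_Hom[OF h(1) ev] comp_Hom[OF h'(1) ev]] .
  then show "g = g'"
    using transpose_unique[OF e q c g(1) h g(2) h'] by simp
qed

text \<open>
  If a family \<open>K\<close> of arrows into \<open>a\<close> is jointly epic, then so is the family of all arrows into
  \<open>a \<times> c\<close> whose first component factors through a member of \<open>K\<close>. Transposing \<open>f\<close> and
  \<open>f'\<close> along \<open>_ \<times> c\<close> turns the claim into one about two arrows from \<open>a\<close> to an
  exponential, which can be tested on \<open>K\<close>; restricting the transpose to \<open>k : d \<rightarrow> a\<close> corresponds
  to restricting the original arrow along \<open>k \<times> c : d \<times> c \<rightarrow> a \<times> c\<close>.
\<close>

lemma jointly_epic_product:
  assumes cc: "cartesian_closed C" and K: "K \<subseteq> {k \<in> Arr C. Cod C k = a}" "jointly_epic C K a"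
    and q: "product C a c q \<rho>\<^sub>1 \<rho>\<^sub>2" and ac: "a \<in> Obj C" "c \<in> Obj C"
    and f: "f \<in> Hom C q b" "f' \<in> Hom C q b"
    and agree: "\<And>k z x n. k \<in> K \<Longrightarrow> x \<in> Hom C z (Dom C k) \<Longrightarrow> n \<in> Hom C z q \<Longrightarrow>
      \<rho>\<^sub>1 \<cdot> n = k \<cdot> x \<Longrightarrow> f \<cdot> n = f' \<cdot> n"
  shows "f = f'"
proof -
  have "b \<in> Obj C" using f Hom_Obj by blast
  then obtain e p \<pi>\<^sub>1 \<pi>\<^sub>2 ev where e: "exponential C c b e p \<pi>\<^sub>1 \<pi>\<^sub>2 ev"
    using cc ac unfolding cartesian_closed_def by blast
  then have p: "product C e c p \<pi>\<^sub>1 \<pi>\<^sub>2" and ev: "ev \<in> Hom C p b"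
    by (auto simp: exponential_def)
  note \<pi> = product_proj[OF p] and \<rho> = product_proj[OF q]
  obtain g h where g: "g \<in> Hom C a e" "h \<in> Hom C q p" "\<pi>\<^sub>1 \<cdot> h = g \<cdot> \<rho>\<^sub>1" "\<pi>\<^sub>2 \<cdot> h = \<rho>\<^sub>2" "ev \<cdot> h = f"
    using transpose[OF e q ac(1) f(1)] .
  obtain g' h' where g': "g' \<in> Hom C a e" "h' \<in> Hom C q p" "\<pi>\<^sub>1 \<cdot> h' = g' \<cdot> \<rho>\<^sub>1" "\<pi>\<^sub>2 \<cdot> h' = \<rho>\<^sub>2" "ev \<cdot> h' = f'"
    using transpose[OF e q ac(1) f(2)] .
  have "g \<cdot> k = g' \<cdot> k" if "k \<in> K" for k
  proof -
    let ?d = "Dom C k"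
    have k: "k \<in> Hom C ?d a" using K(1) that by (auto simp: Hom_def)
    then have d: "?d \<in> Obj C" using Hom_Obj by blast
    then obtain z \<sigma>\<^sub>1 \<sigma>\<^sub>2 where z: "product C ?d c z \<sigma>\<^sub>1 \<sigma>\<^sub>2"
      using cc ac unfolding cartesian_closed_def by blast
    note \<sigma> = product_proj[OF z]
    \<comment> \<open>\<open>n\<close> is \<open>k \<times> c\<close>.\<close>
    obtain n where n: "n \<in> Hom C z q" "\<rho>\<^sub>1 \<cdot> n = k \<cdot> \<sigma>\<^sub>1" "\<rho>\<^sub>2 \<cdot> n = \<sigma>\<^sub>2"
      using product_pair[OF q comp_Hom[OF \<sigma>(1) k] \<sigma>(2)] .
    have *: "g \<cdot> k \<in> Hom C ?d e" "h \<cdot> n \<in> Hom C z p"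
        "\<pi>\<^sub>1 \<cdot> (h \<cdot> n) = (g \<cdot> k) \<cdot> \<sigma>\<^sub>1" "\<pi>\<^sub>2 \<cdot> (h \<cdot> n) = \<sigma>\<^sub>2"
      if g: "g \<in> Hom C a e" "h \<in> Hom C q p" "\<pi>\<^sub>1 \<cdot> h = g \<cdot> \<rho>\<^sub>1" "\<pi>\<^sub>2 \<cdot> h = \<rho>\<^sub>2" for g h
    proof -
      show "g \<cdot> k \<in> Hom C ?d e" "h \<cdot> n \<in> Hom C z p" using comp_Hom[OF k g(1)] comp_Hom[OF n(1) g(2)] .
      have "\<pi>\<^sub>1 \<cdot> (h \<cdot> n) = (\<pi>\<^sub>1 \<cdot> h) \<cdot> n" using comp_assoc[OF n(1) g(2) \<pi>(1)] by simp
      also have "\<dots> = g \<cdot> (\<rho>\<^sub>1 \<cdot> n)" using comp_assoc[OF n(1) \<rho>(1) g(1)] g(3) by simp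
      also have "\<dots> = (g \<cdot> k) \<cdot> \<sigma>\<^sub>1" using comp_assoc[OF \<sigma>(1) k g(1)] n(2) by simp
      finally show "\<pi>\<^sub>1 \<cdot> (h \<cdot> n) = (g \<cdot> k) \<cdot> \<sigma>\<^sub>1" .
      show "\<pi>\<^sub>2 \<cdot> (h \<cdot> n) = \<sigma>\<^sub>2" using comp_assoc[OF n(1) g(2) \<pi>(2)] g(4) n(3) by simp
    qed
    have "ev \<cdot> (h \<cdot> n) = f \<cdot> n" using comp_assoc[OF n(1) g(2) ev] g(5) by simp
    also have "\<dots> = f' \<cdot> n" using agree[OF that \<sigma>(1) n(1,2)] .
    also have "\<dots> = ev \<cdot> (h' \<cdot> n)" using comp_assoc[OF n(1) g'(2) ev] g'(5) by simp
    finally show ?thesis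
      using transpose_unique[OF e z d *[OF g(1-4)] *[OF g'(1-4)]] by simp
  qed
  then have "g = g'" using K(2) g(1) g'(1) by (auto simp: jointly_epic_def)
  then have "h = h'" using product_eqI[OF p g(2) g'(2)] g(3,4) g'(3,4) by simp
  then show "f = f'" using g(5) g'(5) by simp
qed

section \<open>Joins of thin objects\<close>

lemma jointly_epic_colimit:
  assumes D: "is_functor J C D" and colim: "colimit_cocone J C D c \<iota>"
  shows "jointly_epic C (\<iota> ` Obj J) c"
  unfolding jointly_epic_def
proof (intro allI ballI impI)
  fix b f g assume f: "f \<in> Hom C c b" and g: "g \<in> Hom C c b" and eq: "\<forall>k\<in>\<iota> ` Obj J. f \<cdot> k = g \<cdot> k"
  have \<iota>: "\<iota> j \<in> Hom C (on_obj D j) c" if "j \<in> Obj J" for j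
    using colim that by (auto simp: colimit_cocone_def cocone_def)
  have "cocone J C D b (\<lambda>j. f \<cdot> \<iota> j)"
    unfolding cocone_def
  proof (intro conjI ballI)
    show "b \<in> Obj C" using f Hom_Obj by blast
    show "f \<cdot> \<iota> j \<in> Hom C (on_obj D j) b" if "j \<in> Obj J" for j using comp_Hom[OF \<iota>[OF that] f] .
    fix k assume k: "k \<in> Arr J"
    then have "on_arr D k \<in> Hom C (on_obj D (Dom J k)) (on_obj D (Cod J k))" "Cod J k \<in> Obj J"
      using D by (auto simp: is_functor_def category_def)
    then show "f \<cdot> \<iota> (Cod J k) \<cdot> on_arr D k = f \<cdot> \<iota> (Dom J k)"
      using comp_assoc[OF _ \<iota> f] colim k by (auto simp: colimit_cocone_def cocone_def)
  qed
  then have "\<exists>!h. h \<in> Hom C c b \<and> (\<forall>j\<in>Obj J. h \<cdot> \<iota> j = f \<cdot> \<iota> j)"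
    using colim unfolding colimit_cocone_def by blast
  then show "f = g" using f g eq by auto
qed

text \<open>
  Thin objects form a preorder, so a small set of them spans a small diagram with at most one arrow
  between two members. The index category has the elements of \<open>A\<close> as objects and encoded pairs
  as arrows, which keeps both in the type of the universe.
\<close>

lemma thin_diagram_colimit:
  fixes U :: "'u set set"
  assumes U: "universe U" and cocomp: "cocomplete U C" and A: "A \<in> U"
    and r: "\<And>a. a \<in> A \<Longrightarrow> thin_object C (r a)"
  obtains c \<iota> where "c \<in> Obj C" "\<And>a. a \<in> A \<Longrightarrow> \<iota> a \<in> Hom C (r a) c"
    "\<And>a b k. a \<in> A \<Longrightarrow> b \<in> A \<Longrightarrow> k \<in> Hom C (r a) (r b) \<Longrightarrow> \<iota> b \<cdot> k = \<iota> a"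
    "jointly_epic C (\<iota> ` A) c"
    "\<And>w. thin_object C w \<Longrightarrow> (\<And>a. a \<in> A \<Longrightarrow> Hom C (r a) w \<noteq> {}) \<Longrightarrow> Hom C c w \<noteq> {}"
proof -
  obtain q :: "'u \<times> 'u \<Rightarrow> 'u" where q: "inj_on q (A \<times> A)" "q ` (A \<times> A) \<in> U"
    using universe_pairing[OF U A] .
  define R where "R = {(a, b) \<in> A \<times> A. Hom C (r a) (r b) \<noteq> {}}"
  define arr where "arr = inv_into (A \<times> A) q"
  define J :: "('u, 'u) cat" where
    "J = \<lparr>Obj = A, Arr = q ` R, Dom = fst \<circ> arr, Cod = snd \<circ> arr, Id = (\<lambda>a. q (a, a)),
          Comp = (\<lambda>g f. q (fst (arr f), snd (arr g)))\<rparr>"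
  define the_arr where "the_arr a b = (SOME k. k \<in> Hom C (r a) (r b))" for a b
  define D :: "('u, 'u, 'o, 'm) functor_data" where
    "D = \<lparr>on_obj = r, on_arr = (\<lambda>k. the_arr (fst (arr k)) (snd (arr k)))\<rparr>"
  have RA: "R \<subseteq> A \<times> A" by (auto simp: R_def)
  have arr_q: "arr (q x) = x" if "x \<in> R" for x
    unfolding arr_def using q(1) RA that by (intro inv_into_f_f) auto
  have R_refl: "(a, a) \<in> R" if "a \<in> A" for a
    using that Id_Hom[of "r a"] r[OF that] by (auto simp: R_def thin_object_def)
  have R_trans: "(a, b) \<in> R \<Longrightarrow> (b, c) \<in> R \<Longrightarrow> (a, c) \<in> R" for a b c
    using Hom_trans[of "r a" "r b" "r c"] by (simp add: R_def)
  have the_arr: "the_arr a b \<in> Hom C (r a) (r b)" if "(a, b) \<in> R" for a b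
    using that by (auto simp: R_def the_arr_def some_in_eq)
  have the_arr_eq: "the_arr a b = k" if "(a, b) \<in> R" "k \<in> Hom C (r a) (r b)" for a b k
    using thin_objectD[OF r the_arr[OF that(1)] that(2)] RA that(1) by blast
  have A_R: "a \<in> A" "b \<in> A" if "(a, b) \<in> R" for a b
    using that RA by auto
  have J: "category J"
    unfolding category_def Hom_def J_def
    by (auto simp: arr_q R_refl A_R) (metis R_trans arr_q fst_conv snd_conv image_eqI)+
  have D: "is_functor J C D"
    unfolding is_functor_def
  proof (intro conjI ballI impI)
    show "on_obj D a \<in> Obj C" if "a \<in> Obj J" for a
      using that r by (auto simp: J_def D_def thin_object_def)
    show "on_arr D f \<in> Hom C (on_obj D (Dom J f)) (on_obj D (Cod J f))" if "f \<in> Arr J" for f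
      using that the_arr by (auto simp: J_def D_def arr_q)
    show "on_arr D (Id J a) = Id C (on_obj D a)" if "a \<in> Obj J" for a
      using that r by (auto simp: J_def D_def arr_q R_refl thin_object_def intro!: the_arr_eq Id_Hom)
    show "on_arr D (g \<cdot>\<^bsub>J\<^esub> f) = on_arr D g \<cdot> on_arr D f"
      if fg: "f \<in> Arr J" "g \<in> Arr J" "Cod J f = Dom J g" for f g
    proof -
      obtain a b c where R: "(a, b) \<in> R" "(b, c) \<in> R" and "f = q (a, b)" "g = q (b, c)"
        using fg by (auto simp: J_def arr_q)
      then show ?thesis
        using the_arr_eq[OF R_trans[OF R] comp_Hom[OF the_arr the_arr, OF R]]
        by (simp add: J_def D_def arr_q R_trans[OF R])
    qed
  qed (fact J C)+
  have "Arr J \<in> U" using universe_subset[OF U q(2) image_mono[OF RA]] by (simp add: J_def)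
  moreover have "Obj J \<in> U" using A by (simp add: J_def)
  ultimately obtain c \<iota> where colim: "colimit_cocone J C D c \<iota>"
    using cocomp[unfolded cocomplete_def, rule_format, of J D] D by blast
  show thesis
  proof
    show "c \<in> Obj C" using colim by (simp add: colimit_cocone_def cocone_def)
    show "\<iota> a \<in> Hom C (r a) c" if "a \<in> A" for a
      using colim that by (simp add: colimit_cocone_def cocone_def J_def D_def)
    show "\<iota> b \<cdot> k = \<iota> a" if "a \<in> A" "b \<in> A" "k \<in> Hom C (r a) (r b)" for a b k
    proof -
      have ab: "(a, b) \<in> R" using that by (auto simp: R_def)
      then have "\<iota> (Cod J (q (a, b))) \<cdot> on_arr D (q (a, b)) = \<iota> (Dom J (q (a, b)))"
        using colim by (simp add: colimit_cocone_def cocone_def J_def)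
      then show ?thesis using the_arr_eq[OF ab that(3)] by (simp add: J_def D_def arr_q ab)
    qed
    show "jointly_epic C (\<iota> ` A) c"
      using jointly_epic_colimit[OF D colim] by (simp add: J_def)
    fix w assume w: "thin_object C w" and rw: "\<And>a. a \<in> A \<Longrightarrow> Hom C (r a) w \<noteq> {}"
    define \<kappa> where "\<kappa> a = (SOME k. k \<in> Hom C (r a) w)" for a
    have \<kappa>: "\<kappa> a \<in> Hom C (r a) w" if "a \<in> A" for a
      using rw[OF that] by (simp add: \<kappa>_def some_in_eq)
    have "cocone J C D w \<kappa>"
      unfolding cocone_def
    proof (intro conjI ballI)
      show "w \<in> Obj C" using w by (simp add: thin_object_def)
      show "\<kappa> j \<in> Hom C (on_obj D j) w" if "j \<in> Obj J" for j
        using that \<kappa> by (simp add: J_def D_def)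
      fix k assume "k \<in> Arr J"
      then obtain a b where ab: "(a, b) \<in> R" "k = q (a, b)" by (auto simp: J_def)
      have "\<kappa> b \<cdot> the_arr a b = \<kappa> a"
        using thin_objectD[OF w comp_Hom[OF the_arr[OF ab(1)] \<kappa>] \<kappa>] A_R[OF ab(1)] by simp
      then show "\<kappa> (Cod J k) \<cdot> on_arr D k = \<kappa> (Dom J k)"
        using ab by (simp add: J_def D_def arr_q)
    qed
    then show "Hom C c w \<noteq> {}" using colim unfolding colimit_cocone_def by blast
  qed
qed

text \<open>
  Let \<open>c\<close> be the colimit of the family, with injections \<open>\<iota>\<close>. Any two arrows \<open>\<iota> a \<cdot> x\<close>
  and \<open>\<iota> b \<cdot> y\<close> from the same object are equal, since both factor through the meet of \<open>r a\<close>
  and \<open>r b\<close>, which is a member of the diagram. As the arrows that factor through some \<open>\<iota> b\<close>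
  in one component are jointly epic into \<open>c \<times> r a\<close> and into \<open>c \<times> c\<close>, the two projections
  from \<open>c \<times> c\<close> coincide. So \<open>c\<close> is thin.
\<close>

lemma thin_object_join_of_ideal:
  fixes U :: "'u set set"
  assumes U: "universe U" and cocomp: "cocomplete U C" and cc: "cartesian_closed C" and A: "A \<in> U"
    and r: "\<And>a. a \<in> A \<Longrightarrow> thin_object C (r a)"
    and meet: "\<And>a b p \<pi>\<^sub>1 \<pi>\<^sub>2. a \<in> A \<Longrightarrow> b \<in> A \<Longrightarrow> product C (r a) (r b) p \<pi>\<^sub>1 \<pi>\<^sub>2 \<Longrightarrow>
      \<exists>d\<in>A. Hom C p (r d) \<noteq> {} \<and> Hom C (r d) p \<noteq> {}"
  obtains c where "thin_object C c" "\<And>a. a \<in> A \<Longrightarrow> Hom C (r a) c \<noteq> {}"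
    "\<And>w. thin_object C w \<Longrightarrow> (\<And>a. a \<in> A \<Longrightarrow> Hom C (r a) w \<noteq> {}) \<Longrightarrow> Hom C c w \<noteq> {}"
proof (rule thin_diagram_colimit[OF U cocomp A r])
  fix c \<iota>
  assume c: "c \<in> Obj C" and \<iota>: "\<And>a. a \<in> A \<Longrightarrow> \<iota> a \<in> Hom C (r a) c"
    and \<iota>_comp: "\<And>a b k. a \<in> A \<Longrightarrow> b \<in> A \<Longrightarrow> k \<in> Hom C (r a) (r b) \<Longrightarrow> \<iota> b \<cdot> k = \<iota> a"
    and epi: "jointly_epic C (\<iota> ` A) c"
    and least: "\<And>w. thin_object C w \<Longrightarrow> (\<And>a. a \<in> A \<Longrightarrow> Hom C (r a) w \<noteq> {}) \<Longrightarrow> Hom C c w \<noteq> {}"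
  have K: "\<iota> ` A \<subseteq> {k \<in> Arr C. Cod C k = c}" and Dom_\<iota>: "\<And>a. a \<in> A \<Longrightarrow> Dom C (\<iota> a) = r a"
    using \<iota> by (auto simp: Hom_def)
  have rO: "r a \<in> Obj C" if "a \<in> A" for a using r[OF that] by (simp add: thin_object_def)
  have agree: "\<iota> a \<cdot> x = \<iota> b \<cdot> y"
    if a: "a \<in> A" "x \<in> Hom C z (r a)" and b: "b \<in> A" "y \<in> Hom C z (r b)" for a b x y z
  proof -
    obtain p \<pi>\<^sub>1 \<pi>\<^sub>2 where p: "product C (r a) (r b) p \<pi>\<^sub>1 \<pi>\<^sub>2"
      using cc rO a b unfolding cartesian_closed_def by blast
    note \<pi> = product_proj[OF p]
    obtain d m l where d: "d \<in> A" "m \<in> Hom C p (r d)" "l \<in> Hom C (r d) p"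
      using meet[OF a(1) b(1) p] by blast
    obtain h where h: "h \<in> Hom C z p"
      using product_pair[OF p a(2) b(2)] .
    have mh: "m \<cdot> h \<in> Hom C z (r d)" using comp_Hom[OF h d(2)] .
    have *: "\<iota> a \<cdot> x = \<iota> d \<cdot> (m \<cdot> h)"
      if a: "a \<in> A" "x \<in> Hom C z (r a)" "\<pi> \<in> Hom C p (r a)" for a x \<pi>
    proof -
      have \<pi>l: "\<pi> \<cdot> l \<in> Hom C (r d) (r a)" using comp_Hom[OF d(3) a(3)] .
      have "x = (\<pi> \<cdot> l) \<cdot> (m \<cdot> h)"
        using thin_objectD[OF r[OF a(1)] a(2) comp_Hom[OF mh \<pi>l]] .
      then have "\<iota> a \<cdot> x = (\<iota> a \<cdot> (\<pi> \<cdot> l)) \<cdot> (m \<cdot> h)"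
        using comp_assoc[OF mh \<pi>l \<iota>[OF a(1)]] by simp
      then show ?thesis using \<iota>_comp[OF d(1) a(1) \<pi>l] by simp
    qed
    show ?thesis using *[OF a] *[OF b] \<pi> by simp
  qed
  \<comment> \<open>The first projection from \<open>c \<times> r a\<close> equals \<open>\<iota> a\<close> after the second one,
    so in \<open>agree\<close> one of the two arrows may be arbitrary.\<close>
  have absorb: "y = \<iota> a \<cdot> x" if a: "a \<in> A" and x: "x \<in> Hom C z (r a)" and y: "y \<in> Hom C z c" for a x y z
  proof -
    obtain q \<rho>\<^sub>1 \<rho>\<^sub>2 where q: "product C c (r a) q \<rho>\<^sub>1 \<rho>\<^sub>2"
      using cc c rO[OF a] unfolding cartesian_closed_def by blast
    note \<rho> = product_proj[OF q]
    have \<iota>\<rho>: "\<iota> a \<cdot> \<rho>\<^sub>2 \<in> Hom C q c" using comp_Hom[OF \<rho>(2) \<iota>[OF a]] .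
    have "\<rho>\<^sub>1 = \<iota> a \<cdot> \<rho>\<^sub>2"
    proof (rule jointly_epic_product[OF cc K epi q c rO[OF a] _ \<iota>\<rho>])
      fix k w v n assume k: "k \<in> \<iota> ` A" "v \<in> Hom C w (Dom C k)" and n: "n \<in> Hom C w q" "\<rho>\<^sub>1 \<cdot> n = k \<cdot> v"
      then obtain b where b: "b \<in> A" "k = \<iota> b" by blast
      have "\<rho>\<^sub>2 \<cdot> n \<in> Hom C w (r a)" using comp_Hom[OF n(1) \<rho>(2)] .
      then have "k \<cdot> v = \<iota> a \<cdot> (\<rho>\<^sub>2 \<cdot> n)"
        using agree[OF b(1) _ a] k(2) b Dom_\<iota> by simp
      then show "\<rho>\<^sub>1 \<cdot> n = (\<iota> a \<cdot> \<rho>\<^sub>2) \<cdot> n"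
        using n comp_assoc[OF n(1) \<rho>(2) \<iota>[OF a]] by simp
    qed (use \<rho> in simp)
    moreover obtain h where h: "h \<in> Hom C z q" "\<rho>\<^sub>1 \<cdot> h = y" "\<rho>\<^sub>2 \<cdot> h = x"
      using product_pair[OF q y x] .
    ultimately show ?thesis using comp_assoc[OF h(1) \<rho>(2) \<iota>[OF a]] by simp
  qed
  have "f = g" if fg: "f \<in> Hom C z c" "g \<in> Hom C z c" for z f g
  proof -
    obtain q \<rho>\<^sub>1 \<rho>\<^sub>2 where q: "product C c c q \<rho>\<^sub>1 \<rho>\<^sub>2"
      using cc c unfolding cartesian_closed_def by blast
    note \<rho> = product_proj[OF q]
    have "\<rho>\<^sub>1 = \<rho>\<^sub>2"
    proof (rule jointly_epic_product[OF cc K epi q c c])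
      fix k w v n assume k: "k \<in> \<iota> ` A" "v \<in> Hom C w (Dom C k)" and n: "n \<in> Hom C w q" "\<rho>\<^sub>1 \<cdot> n = k \<cdot> v"
      then obtain b where b: "b \<in> A" "k = \<iota> b" by blast
      have "\<rho>\<^sub>2 \<cdot> n \<in> Hom C w c" using comp_Hom[OF n(1) \<rho>(2)] .
      then show "\<rho>\<^sub>1 \<cdot> n = \<rho>\<^sub>2 \<cdot> n"
        using absorb[OF b(1)] k(2) b Dom_\<iota> n by simp
    qed (use \<rho> in auto)
    moreover obtain h where "h \<in> Hom C z q" "\<rho>\<^sub>1 \<cdot> h = f" "\<rho>\<^sub>2 \<cdot> h = g"
      using product_pair[OF q fg] .
    ultimately show ?thesis by simp
  qed
  then have "thin_object C c" using c by (auto simp: thin_object_def)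
  then show thesis using that \<iota> least by blast
qed

text \<open>
  Two thin objects with the same classifying arrow are both pullbacks of \<open>tr\<close> along that arrow,
  so there are arrows between them in both directions. Hence the set of arrows from the terminal
  object to \<open>\<Omega>\<close>, which is small, indexes all thin objects up to isomorphism.
\<close>

lemma thin_objects_small:
  fixes U :: "'u set set"
  assumes U: "universe U" and small: "locally_small U C" and \<Omega>: "subobject_classifier C \<Omega> tr"
  obtains R and r :: "'u \<Rightarrow> 'o" where "R \<in> U" "\<And>a. a \<in> R \<Longrightarrow> thin_object C (r a)"
    "\<And>u. thin_object C u \<Longrightarrow> \<exists>a\<in>R. Hom C u (r a) \<noteq> {} \<and> Hom C (r a) u \<noteq> {}"
proof -
  define t where "t = Dom C tr"
  have t: "terminal C t" "\<Omega> \<in> Obj C"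
    using \<Omega> by (simp_all add: subobject_classifier_def t_def)
  then have "t \<in> Obj C" by (simp add: terminal_def)
  have "\<exists>S\<in>U. S \<approx> Hom C t \<Omega>" using small \<open>t \<in> Obj C\<close> t by (simp add: locally_small_def)
  then obtain S e where S: "S \<in> U" and e: "bij_betw e S (Hom C t \<Omega>)" by (auto simp: eqpoll_def)
  \<comment> \<open>\<open>\<chi>\<close> classifies the arrow from \<open>u\<close> to the terminal object.\<close>
  define cls where "cls u \<chi> \<longleftrightarrow> thin_object C u \<and>
    (\<exists>m\<in>Hom C u t. \<exists>k\<in>Hom C u t. pullback C \<chi> tr m k)" for u \<chi>
  define R where "R = {s \<in> S. \<exists>u. cls u (e s)}"
  define r where "r s = (SOME u. cls u (e s))" for s
  have r: "cls (r s) (e s)" if "s \<in> R" for s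
    using that someI_ex[of "\<lambda>u. cls u (e s)"] by (auto simp: R_def r_def)
  have le: "Hom C u v \<noteq> {}" if "cls u \<chi>" "cls v \<chi>" for u v \<chi>
  proof -
    obtain m k where m: "m \<in> Hom C u t" "k \<in> Hom C u t" "pullback C \<chi> tr m k"
      using \<open>cls u \<chi>\<close> unfolding cls_def by blast
    obtain m' k' where m': "m' \<in> Hom C v t" "k' \<in> Hom C v t" "pullback C \<chi> tr m' k'"
      using \<open>cls v \<chi>\<close> unfolding cls_def by blast
    have "u \<in> Obj C" using m Hom_Obj by blast
    moreover have "Dom C \<chi> = t" "Dom C m' = v"
      using m' by (auto simp: pullback_def Hom_def)
    moreover have "\<chi> \<cdot> m = tr \<cdot> k" using m by (simp add: pullback_def)
    ultimately have "\<exists>h. h \<in> Hom C u v"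
      using m'(3) m(1,2) unfolding pullback_def t_def by metis
    then show ?thesis by blast
  qed
  have "R \<in> U" using universe_subset[OF U S] by (auto simp: R_def)
  moreover have "thin_object C (r a)" if "a \<in> R" for a
    using r[OF that] by (simp add: cls_def)
  moreover have "\<exists>a\<in>R. Hom C u (r a) \<noteq> {} \<and> Hom C (r a) u \<noteq> {}" if u: "thin_object C u" for u
  proof -
    obtain m where m: "m \<in> Hom C u t" using t u by (auto simp: terminal_def thin_object_def)
    then have "monic C m" "Cod C m = t" "Dom C m = u"
      using u by (auto simp: monic_def Hom_def thin_object_def)
    then obtain \<chi> k where \<chi>: "\<chi> \<in> Hom C t \<Omega>" and k: "k \<in> Hom C u t" "pullback C \<chi> tr m k"
      using \<Omega> unfolding subobject_classifier_def t_def by metis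
    have "\<chi> \<in> e ` S" using bij_betw_imp_surj_on[OF e] \<chi> by simp
    then obtain a where "a \<in> S" and a: "e a = \<chi>" by (elim imageE) simp
    have "cls u (e a)" unfolding cls_def a using u m k by (intro conjI bexI)
    moreover from this have "a \<in> R" using \<open>a \<in> S\<close> by (auto simp: R_def)
    ultimately show ?thesis using le[OF _ r] le[OF r] by (intro bexI[of _ a] conjI)
  qed
  ultimately show thesis using that by blast
qed

text \<open>
  The family of all thin objects below some member of \<open>S\<close> has the same upper bounds as \<open>S\<close>,
  is small up to isomorphism, and is closed under products.
\<close>

lemma thin_object_join:
  fixes U :: "'u set set"
  assumes U: "universe U" and topos: "elementary_topos C" and small: "locally_small U C"
    and cocomp: "cocomplete U C" and S: "\<And>s. s \<in> S \<Longrightarrow> thin_object C s"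
  obtains c where "thin_object C c" "\<And>s. s \<in> S \<Longrightarrow> Hom C s c \<noteq> {}"
    "\<And>w. thin_object C w \<Longrightarrow> (\<And>s. s \<in> S \<Longrightarrow> Hom C s w \<noteq> {}) \<Longrightarrow> Hom C c w \<noteq> {}"
proof -
  have cc: "cartesian_closed C" using topos by (simp add: elementary_topos_def)
  obtain \<Omega> tr where \<Omega>: "subobject_classifier C \<Omega> tr" using topos unfolding elementary_topos_def by blast
  show thesis
  proof (rule thin_objects_small[OF U small \<Omega>])
    fix R and r :: "'u \<Rightarrow> 'o"
    assume R: "R \<in> U" and r: "\<And>a. a \<in> R \<Longrightarrow> thin_object C (r a)"
      and rep: "\<And>u. thin_object C u \<Longrightarrow> \<exists>a\<in>R. Hom C u (r a) \<noteq> {} \<and> Hom C (r a) u \<noteq> {}"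
    define A where "A = {a \<in> R. \<exists>s\<in>S. Hom C (r a) s \<noteq> {}}"
    have A: "A \<in> U" using universe_subset[OF U R] by (auto simp: A_def)
    have rA: "\<And>a. a \<in> A \<Longrightarrow> thin_object C (r a)" using r by (auto simp: A_def)
    have meet: "\<exists>d\<in>A. Hom C p (r d) \<noteq> {} \<and> Hom C (r d) p \<noteq> {}"
      if "a \<in> A" "b \<in> A" and p: "product C (r a) (r b) p \<pi>\<^sub>1 \<pi>\<^sub>2" for a b p \<pi>\<^sub>1 \<pi>\<^sub>2
    proof -
      obtain s where a: "a \<in> R" "b \<in> R" "s \<in> S" "Hom C (r a) s \<noteq> {}"
        using \<open>a \<in> A\<close> \<open>b \<in> A\<close> by (auto simp: A_def)
      obtain d where d: "d \<in> R" "Hom C p (r d) \<noteq> {}" "Hom C (r d) p \<noteq> {}"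
        using rep[OF thin_object_product[OF r[OF a(1)] r[OF a(2)] p]] by blast
      have "Hom C p (r a) \<noteq> {}" using product_proj[OF p] by blast
      then have "Hom C (r d) s \<noteq> {}" using Hom_trans[OF Hom_trans[OF d(3)] a(4)] by simp
      then show ?thesis using d a(3) by (auto simp: A_def)
    qed
    show thesis
    proof (rule thin_object_join_of_ideal[where r = r, OF U cocomp cc A])
      show "\<And>a. a \<in> A \<Longrightarrow> thin_object C (r a)" by (fact rA)
      show "\<And>a b p \<pi>\<^sub>1 \<pi>\<^sub>2. a \<in> A \<Longrightarrow> b \<in> A \<Longrightarrow> product C (r a) (r b) p \<pi>\<^sub>1 \<pi>\<^sub>2 \<Longrightarrow>
        \<exists>d\<in>A. Hom C p (r d) \<noteq> {} \<and> Hom C (r d) p \<noteq> {}" by (fact meet)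
    next
      fix c assume c: "thin_object C c" "\<And>a. a \<in> A \<Longrightarrow> Hom C (r a) c \<noteq> {}"
        "\<And>w. thin_object C w \<Longrightarrow> (\<And>a. a \<in> A \<Longrightarrow> Hom C (r a) w \<noteq> {}) \<Longrightarrow> Hom C c w \<noteq> {}"
      show thesis
      proof (rule that[OF c(1)])
        fix s assume s: "s \<in> S"
        obtain a where a: "a \<in> R" "Hom C s (r a) \<noteq> {}" "Hom C (r a) s \<noteq> {}" using rep[OF S[OF s]] by blast
        then have "a \<in> A" using s by (auto simp: A_def)
        then show "Hom C s c \<noteq> {}" using Hom_trans[OF a(2) c(2)] by simp
      next
        fix w assume w: "thin_object C w" "\<And>s. s \<in> S \<Longrightarrow> Hom C s w \<noteq> {}"
        have "Hom C (r a) w \<noteq> {}" if "a \<in> A" for a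
          using that Hom_trans[OF _ w(2)] by (auto simp: A_def)
        then show "Hom C c w \<noteq> {}" using c(3)[OF w(1)] by simp
      qed
    qed
  qed
qed

end

section \<open>The frame of subterminal objects\<close>

context
  fixes E :: "('o, 'm) cat"
  assumes topos: "elementary_topos E"
begin

lemma topos_category: "category E" and topos_closed: "cartesian_closed E"
  using topos by (auto simp: elementary_topos_def)

lemma topos_subterminal_iff: "subterminal E u \<longleftrightarrow> thin_object E u"
  using topos_closed subterminal_iff_thin_object[OF topos_category]
  unfolding cartesian_closed_def by blast

lemma carrier_Sub_one: "carrier (Sub_one E) = iso_class E ` {u. thin_object E u}"
  by (simp add: Sub_one_def topos_subterminal_iff)

lemma mem_iso_class_iff:
  assumes u: "thin_object E u"
  shows "v \<in> iso_class E u \<longleftrightarrow> thin_object E v \<and> Hom E u v \<noteq> {} \<and> Hom E v u \<noteq> {}"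
proof
  assume "v \<in> iso_class E u"
  then have "isomorphic E u v" by (simp add: iso_class_def)
  moreover from this have "thin_object E v" using thin_object_isomorphic[OF topos_category u] by simp
  ultimately show "thin_object E v \<and> Hom E u v \<noteq> {} \<and> Hom E v u \<noteq> {}"
    using isomorphic_thin_object_iff[OF topos_category u] by simp
next
  assume "thin_object E v \<and> Hom E u v \<noteq> {} \<and> Hom E v u \<noteq> {}"
  then show "v \<in> iso_class E u"
    using isomorphic_thin_object_iff[OF topos_category u] by (simp add: iso_class_def thin_object_def)
qed

lemma self_mem_iso_class: "thin_object E u \<Longrightarrow> u \<in> iso_class E u"
  using Id_Hom[OF topos_category, of u] mem_iso_class_iff[of u u] by (auto simp: thin_object_def)

lemma Sub_one_le_iff:
  assumes u: "thin_object E u" and v: "thin_object E v"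
  shows "iso_class E u \<sqsubseteq>\<^bsub>Sub_one E\<^esub> iso_class E v \<longleftrightarrow> Hom E u v \<noteq> {}"
proof
  assume "iso_class E u \<sqsubseteq>\<^bsub>Sub_one E\<^esub> iso_class E v"
  then obtain u' v' where "u' \<in> iso_class E u" "v' \<in> iso_class E v" and u'v': "Hom E u' v' \<noteq> {}"
    by (auto simp: Sub_one_def)
  then have "Hom E u u' \<noteq> {}" "Hom E v' v \<noteq> {}"
    using mem_iso_class_iff u v by simp_all
  then show "Hom E u v \<noteq> {}"
    using Hom_trans[OF topos_category Hom_trans[OF topos_category _ u'v']] by simp
next
  assume "Hom E u v \<noteq> {}"
  then show "iso_class E u \<sqsubseteq>\<^bsub>Sub_one E\<^esub> iso_class E v"
    using self_mem_iso_class[OF u] self_mem_iso_class[OF v] by (auto simp: Sub_one_def)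
qed

lemma iso_class_eqI:
  assumes u: "thin_object E u" and v: "thin_object E v" and uv: "Hom E u v \<noteq> {}" "Hom E v u \<noteq> {}"
  shows "iso_class E u = iso_class E v"
proof (rule Set.set_eqI)
  fix w
  note trans = Hom_trans[OF topos_category]
  show "w \<in> iso_class E u \<longleftrightarrow> w \<in> iso_class E v"
    unfolding mem_iso_class_iff[OF u] mem_iso_class_iff[OF v]
    using trans[OF uv(1), of w] trans[OF uv(2), of w] trans[OF _ uv(1), of w] trans[OF _ uv(2), of w]
    by auto
qed

lemma Sub_one_cases:
  assumes "c \<in> carrier (Sub_one E)"
  obtains u where "thin_object E u" "c = iso_class E u"
  using assms by (auto simp: carrier_Sub_one)

lemma iso_class_carrier: "thin_object E u \<Longrightarrow> iso_class E u \<in> carrier (Sub_one E)"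
  by (simp add: carrier_Sub_one)

lemma iso_class_of_mem:
  assumes "c \<in> carrier (Sub_one E)" "u \<in> c"
  shows "thin_object E u" "c = iso_class E u"
proof -
  obtain v where v: "thin_object E v" "c = iso_class E v" using assms(1) by (rule Sub_one_cases)
  then show "thin_object E u" "c = iso_class E u"
    using mem_iso_class_iff[OF v(1), of u] assms(2) iso_class_eqI[OF v(1), of u] by simp_all
qed

lemma Sub_one_partial_order: "partial_order (Sub_one E)"
proof
  fix c d e
  show "c .=\<^bsub>Sub_one E\<^esub> c" by (simp add: Sub_one_def)
  show "d .=\<^bsub>Sub_one E\<^esub> c" if "c .=\<^bsub>Sub_one E\<^esub> d" using that by (simp add: Sub_one_def)
  show "c .=\<^bsub>Sub_one E\<^esub> e" if "c .=\<^bsub>Sub_one E\<^esub> d" "d .=\<^bsub>Sub_one E\<^esub> e"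
    using that by (simp add: Sub_one_def)
  show "(.=\<^bsub>Sub_one E\<^esub>) = (=)" by (simp add: Sub_one_def)
  show "(c \<sqsubseteq>\<^bsub>Sub_one E\<^esub> d') = (c' \<sqsubseteq>\<^bsub>Sub_one E\<^esub> e')"
    if "c .=\<^bsub>Sub_one E\<^esub> c'" "d' .=\<^bsub>Sub_one E\<^esub> e'" for c' d' e'
    using that by (simp add: Sub_one_def)
  assume c: "c \<in> carrier (Sub_one E)"
  then obtain u where u: "thin_object E u" "c = iso_class E u" by (rule Sub_one_cases)
  then show "c \<sqsubseteq>\<^bsub>Sub_one E\<^esub> c"
    using self_mem_iso_class mem_iso_class_iff by (simp add: Sub_one_le_iff)
  assume d: "d \<in> carrier (Sub_one E)"
  then obtain v where v: "thin_object E v" "d = iso_class E v" by (rule Sub_one_cases)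
  show "c .=\<^bsub>Sub_one E\<^esub> d" if "c \<sqsubseteq>\<^bsub>Sub_one E\<^esub> d" "d \<sqsubseteq>\<^bsub>Sub_one E\<^esub> c"
  proof -
    have "Hom E u v \<noteq> {}" "Hom E v u \<noteq> {}"
      using that Sub_one_le_iff[OF u(1) v(1)] Sub_one_le_iff[OF v(1) u(1)] u(2) v(2) by auto
    then have "c = d" using iso_class_eqI[OF u(1) v(1)] u(2) v(2) by simp
    then show ?thesis by (simp add: Sub_one_def)
  qed
  assume e: "e \<in> carrier (Sub_one E)"
  then obtain w where w: "thin_object E w" "e = iso_class E w" by (rule Sub_one_cases)
  show "c \<sqsubseteq>\<^bsub>Sub_one E\<^esub> e" if "c \<sqsubseteq>\<^bsub>Sub_one E\<^esub> d" "d \<sqsubseteq>\<^bsub>Sub_one E\<^esub> e"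
    using that u v w Hom_trans[OF topos_category, of u v w] by (simp add: Sub_one_le_iff)
qed

interpretation Sub: partial_order "Sub_one E" by (fact Sub_one_partial_order)

lemma Sub_one_top: "terminal E t \<Longrightarrow> \<top>\<^bsub>Sub_one E\<^esub> = iso_class E t"
proof (rule Sub.top_eqI)
  assume t: "terminal E t"
  have th: "thin_object E t"
    by (rule terminal_thin_object[OF topos_category t])
  then show "iso_class E t \<in> carrier (Sub_one E)" by (rule iso_class_carrier)
  fix c assume "c \<in> carrier (Sub_one E)"
  then obtain u where u: "thin_object E u" "c = iso_class E u" by (rule Sub_one_cases)
  then show "c \<sqsubseteq>\<^bsub>Sub_one E\<^esub> iso_class E t"
    using t by (auto simp: Sub_one_le_iff[OF u(1) th] terminal_def thin_object_def)
qed

lemma Sub_one_meet: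
  assumes u: "thin_object E u" and v: "thin_object E v" and p: "product E u v p \<pi>\<^sub>1 \<pi>\<^sub>2"
  shows "iso_class E u \<sqinter>\<^bsub>Sub_one E\<^esub> iso_class E v = iso_class E p"
proof (rule Sub.meet_eqI)
  note th = thin_object_product[OF topos_category u v p]
  show "iso_class E u \<in> carrier (Sub_one E)" "iso_class E v \<in> carrier (Sub_one E)"
    "iso_class E p \<in> carrier (Sub_one E)"
    using u v th by (auto intro: iso_class_carrier)
  show "iso_class E p \<sqsubseteq>\<^bsub>Sub_one E\<^esub> iso_class E u" "iso_class E p \<sqsubseteq>\<^bsub>Sub_one E\<^esub> iso_class E v"
    using product_proj[OF p] u v th by (auto simp: Sub_one_le_iff)
  fix c assume c: "c \<in> carrier (Sub_one E)" and le: "c \<sqsubseteq>\<^bsub>Sub_one E\<^esub> iso_class E u" "c \<sqsubseteq>\<^bsub>Sub_one E\<^esub> iso_class E v"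
  obtain w where w: "thin_object E w" "c = iso_class E w" using c by (rule Sub_one_cases)
  obtain f g where "f \<in> Hom E w u" "g \<in> Hom E w v"
    using le u v w by (auto simp: Sub_one_le_iff)
  from product_pair[OF topos_category p this] show "c \<sqsubseteq>\<^bsub>Sub_one E\<^esub> iso_class E p"
    using w th by (auto simp: Sub_one_le_iff)
qed

lemma topos_product:
  assumes "thin_object E u" "thin_object E v"
  obtains p \<pi>\<^sub>1 \<pi>\<^sub>2 where "product E u v p \<pi>\<^sub>1 \<pi>\<^sub>2"
  using assms topos_closed unfolding cartesian_closed_def thin_object_def by blast

text \<open>
  The implication \<open>a \<Rightarrow> d\<close> is the exponential: an arrow \<open>v \<rightarrow> w\<^sup>u\<close> exists if and only if an arrow
  \<open>v \<times> u \<rightarrow> w\<close> does.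
\<close>

theorem Sub_one_frame:
  fixes U :: "'u set set"
  assumes U: "universe U" and small: "locally_small U E" and cocomp: "cocomplete U E"
  shows "is_frame (Sub_one E)"
proof (rule is_frame_of_implication)
  show "complete_lattice (Sub_one E)"
  proof (rule Sub.complete_lattice_of_sups)
    fix A assume A: "A \<subseteq> carrier (Sub_one E)"
    define S where "S = {u. thin_object E u \<and> iso_class E u \<in> A}"
    obtain j where j: "thin_object E j" and upper: "\<And>s. s \<in> S \<Longrightarrow> Hom E s j \<noteq> {}"
      and least: "\<And>w. thin_object E w \<Longrightarrow> (\<And>s. s \<in> S \<Longrightarrow> Hom E s w \<noteq> {}) \<Longrightarrow> Hom E j w \<noteq> {}"
      using thin_object_join[OF topos_category U topos small cocomp, of S] by (auto simp: S_def)
    have "least (Sub_one E) (iso_class E j) (Upper (Sub_one E) A)"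
    proof (rule least_UpperI)
      show "iso_class E j \<in> carrier (Sub_one E)" by (rule iso_class_carrier[OF j])
    next
      fix c assume "c \<in> A"
      moreover from this obtain u where u: "thin_object E u" "c = iso_class E u"
        using A by (auto elim: Sub_one_cases)
      ultimately show "c \<sqsubseteq>\<^bsub>Sub_one E\<^esub> iso_class E j"
        using upper[of u] by (simp add: Sub_one_le_iff[OF u(1) j] S_def)
    next
      fix d assume d: "d \<in> Upper (Sub_one E) A"
      then have "d \<in> carrier (Sub_one E)" by (auto simp: Upper_def)
      then obtain w where w: "thin_object E w" "d = iso_class E w" by (rule Sub_one_cases)
      have "Hom E j w \<noteq> {}"
      proof (rule least[OF w(1)])
        fix s assume s: "s \<in> S"
        then have "iso_class E s \<sqsubseteq>\<^bsub>Sub_one E\<^esub> d" using d A by (auto simp: S_def Upper_def)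
        then show "Hom E s w \<noteq> {}" using s w by (simp add: Sub_one_le_iff S_def)
      qed
      then show "iso_class E j \<sqsubseteq>\<^bsub>Sub_one E\<^esub> d" using j w by (simp add: Sub_one_le_iff)
    qed (fact A)
    then show "\<exists>s. least (Sub_one E) s (Upper (Sub_one E) A)" ..
  qed
next
  fix a d assume "a \<in> carrier (Sub_one E)" "d \<in> carrier (Sub_one E)"
  then obtain u w where u: "thin_object E u" "a = iso_class E u" and w: "thin_object E w" "d = iso_class E w"
    by (metis Sub_one_cases)
  have "u \<in> Obj E" "w \<in> Obj E" using u w by (auto simp: thin_object_def)
  then obtain e p \<pi>\<^sub>1 \<pi>\<^sub>2 ev where e: "exponential E u w e p \<pi>\<^sub>1 \<pi>\<^sub>2 ev"
    using topos_closed unfolding cartesian_closed_def by blast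
  have th: "thin_object E e"
    using thin_object_exponential[OF topos_category topos_closed e \<open>u \<in> Obj E\<close> w(1)] .
  show "\<exists>e\<in>carrier (Sub_one E). \<forall>c\<in>carrier (Sub_one E).
      c \<sqsubseteq>\<^bsub>Sub_one E\<^esub> e \<longleftrightarrow> a \<sqinter>\<^bsub>Sub_one E\<^esub> c \<sqsubseteq>\<^bsub>Sub_one E\<^esub> d"
  proof (intro bexI ballI)
    show "iso_class E e \<in> carrier (Sub_one E)" by (rule iso_class_carrier[OF th])
    fix c assume "c \<in> carrier (Sub_one E)"
    then obtain v where v: "thin_object E v" "c = iso_class E v" by (rule Sub_one_cases)
    obtain q \<rho>\<^sub>1 \<rho>\<^sub>2 where q: "product E v u q \<rho>\<^sub>1 \<rho>\<^sub>2" using topos_product[OF v(1) u(1)] .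
    have "thin_object E q" using thin_object_product[OF topos_category v(1) u(1) q] .
    moreover have "a \<sqinter>\<^bsub>Sub_one E\<^esub> c = iso_class E q"
      using Sub_one_meet[OF u(1) v(1) product_commute[OF q]] u v by simp
    moreover have "Hom E v e \<noteq> {} \<longleftrightarrow> Hom E q w \<noteq> {}"
      using exponential_arrow_iff[OF topos_category e q] v by (simp add: thin_object_def)
    ultimately show "c \<sqsubseteq>\<^bsub>Sub_one E\<^esub> iso_class E e \<longleftrightarrow> a \<sqinter>\<^bsub>Sub_one E\<^esub> c \<sqsubseteq>\<^bsub>Sub_one E\<^esub> d"
      using v w th by (simp add: Sub_one_le_iff)
  qed
qed

end

section \<open>Maps of sets\<close>

lemma Hom_Set_cat:
  "Hom (Set_cat U) A B = {(A, f, B) |f. A \<in> U \<and> B \<in> U \<and> f \<in> A \<rightarrow>\<^sub>E B}"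
  by (auto simp: Hom_def Set_cat_def)

lemma Hom_Set_cat_nonempty_iff:
  assumes "A \<in> U" "B \<in> U"
  shows "Hom (Set_cat U) A B \<noteq> {} \<longleftrightarrow> (B = {} \<longrightarrow> A = {})"
proof -
  have "Hom (Set_cat U) A B \<noteq> {} \<longleftrightarrow> (A \<rightarrow>\<^sub>E B) \<noteq> {}"
    using assms by (auto simp: Hom_Set_cat)
  then show ?thesis by (auto simp: PiE_eq_empty_iff)
qed

lemma isomorphic_Set_cat_empty_iff:
  assumes "isomorphic (Set_cat U) A B"
  shows "A = {} \<longleftrightarrow> B = {}"
proof -
  have "Hom (Set_cat U) A B \<noteq> {}" "Hom (Set_cat U) B A \<noteq> {}"
    using assms by (auto simp: isomorphic_def)
  moreover from this have "A \<in> U" "B \<in> U" by (auto simp: Hom_Set_cat)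
  ultimately show ?thesis by (auto simp: Hom_Set_cat_nonempty_iff)
qed

lemma terminal_Set_cat_singleton:
  assumes "universe U"
  shows "terminal (Set_cat U) {z}"
proof -
  have "{z} \<in> U" by (rule universe_singleton[OF assms])
  moreover have "A \<rightarrow>\<^sub>E {z} = {\<lambda>x\<in>A. z}" for A
    by (auto intro!: PiE_ext)
  ultimately show ?thesis
    by (auto simp: terminal_def Hom_Set_cat) (simp_all add: Set_cat_def)
qed

section \<open>Preservation of terminal objects and products\<close>

definition empty_cat :: "(nat, nat) cat" where
  "empty_cat = \<lparr>Obj = {}, Arr = {}, Dom = id, Cod = id, Id = id, Comp = (\<lambda>g f. f)\<rparr>"

definition discrete_pair :: "(nat, nat) cat" where
  "discrete_pair = \<lparr>Obj = {0, 1}, Arr = {0, 1}, Dom = id, Cod = id, Id = id, Comp = (\<lambda>g f. f)\<rparr>"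

lemma limit_cone_empty_cat: "limit_cone empty_cat C D t \<tau> \<longleftrightarrow> terminal C t"
  by (simp add: limit_cone_def cone_def terminal_def empty_cat_def Ball_def)

text \<open>
  Only four values of \<open>D\<close> are prescribed, so that the lemma applies both to a diagram and to its
  image under a functor.
\<close>

lemma limit_cone_discrete_pair:
  assumes C: "category C"
    and D: "on_obj D 0 = a" "on_obj D 1 = b" "on_arr D 0 = Id C a" "on_arr D 1 = Id C b"
  shows "limit_cone discrete_pair C D p \<tau> \<longleftrightarrow> product C a b p (\<tau> 0) (\<tau> 1)"
proof -
  have cone: "cone discrete_pair C D c \<sigma> \<longleftrightarrow> c \<in> Obj C \<and> \<sigma> 0 \<in> Hom C c a \<and> \<sigma> 1 \<in> Hom C c b" for c \<sigma>
    using D by (auto simp: cone_def discrete_pair_def Id_left[OF C])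
  show ?thesis
  proof
    assume L: "limit_cone discrete_pair C D p \<tau>"
    have "\<exists>!h. h \<in> Hom C c p \<and> \<tau> 0 \<cdot>\<^bsub>C\<^esub> h = f \<and> \<tau> 1 \<cdot>\<^bsub>C\<^esub> h = g"
      if "c \<in> Obj C" "f \<in> Hom C c a" "g \<in> Hom C c b" for c f g
    proof -
      have "cone discrete_pair C D c (\<lambda>j. if j = 0 then f else g)"
        using that by (simp add: cone)
      then have "\<exists>!h. h \<in> Hom C c p \<and>
          (\<forall>j\<in>Obj discrete_pair. \<tau> j \<cdot>\<^bsub>C\<^esub> h = (if j = 0 then f else g))"
        using L[unfolded limit_cone_def, THEN conjunct2, rule_format] by simp
      then show ?thesis by (simp add: discrete_pair_def)
    qed
    moreover have "p \<in> Obj C \<and> \<tau> 0 \<in> Hom C p a \<and> \<tau> 1 \<in> Hom C p b"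
      using L by (simp add: limit_cone_def cone)
    ultimately show "product C a b p (\<tau> 0) (\<tau> 1)" by (simp add: product_def)
  next
    assume "product C a b p (\<tau> 0) (\<tau> 1)"
    then show "limit_cone discrete_pair C D p \<tau>"
      by (simp add: limit_cone_def cone product_def) (simp add: discrete_pair_def)
  qed
qed

lemma preserves_terminal:
  assumes "is_functor C C' F" "preserves_finite_limits C C' F" "terminal C t"
  shows "terminal C' (on_obj F t)"
proof -
  have "is_functor empty_cat C D" for D
    using assms(1) by (simp add: is_functor_def empty_cat_def category_def)
  then show ?thesis
    using assms(2)[unfolded preserves_finite_limits_def, rule_format, of empty_cat] assms(3)
    by (simp add: limit_cone_empty_cat) (simp add: empty_cat_def)
qed

lemma preserves_product:
  assumes F: "is_functor C C' F" and pres: "preserves_finite_limits C C' F"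
    and p: "product C a b p \<pi>\<^sub>1 \<pi>\<^sub>2" and ab: "a \<in> Obj C" "b \<in> Obj C"
  shows "product C' (on_obj F a) (on_obj F b) (on_obj F p) (on_arr F \<pi>\<^sub>1) (on_arr F \<pi>\<^sub>2)"
proof -
  have C: "category C" "category C'" using F by (auto simp: is_functor_def)
  define D where "D = \<lparr>on_obj = (\<lambda>j::nat. if j = 0 then a else b),
    on_arr = (\<lambda>j::nat. Id C (if j = 0 then a else b))\<rparr>"
  define \<tau> where "\<tau> j = (if j = 0 then \<pi>\<^sub>1 else \<pi>\<^sub>2)" for j :: nat
  have "category discrete_pair"
    by (auto simp: category_def Hom_def discrete_pair_def)
  then have "is_functor discrete_pair C D"
    using C ab Id_Hom[OF C(1)] Id_left[OF C(1) Id_Hom[OF C(1)]]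
    by (auto simp: is_functor_def discrete_pair_def D_def)
  moreover have "limit_cone discrete_pair C D p \<tau>"
    using p limit_cone_discrete_pair[OF C(1), of D a b p \<tau>] by (simp add: D_def \<tau>_def)
  ultimately have "limit_cone discrete_pair C' (functor_comp F D) (on_obj F p) (\<lambda>j. on_arr F (\<tau> j))"
    using pres[unfolded preserves_finite_limits_def, rule_format, of discrete_pair D p \<tau>]
    by (simp add: discrete_pair_def)
  moreover have "on_arr F (Id C a) = Id C' (on_obj F a)" "on_arr F (Id C b) = Id C' (on_obj F b)"
    using F ab by (auto simp: is_functor_def)
  ultimately show ?thesis
    using limit_cone_discrete_pair[OF C(2), of "functor_comp F D" "on_obj F a" "on_obj F b"]
    by (simp add: functor_comp_def D_def \<tau>_def)
qed

section \<open>Stalks of subterminal objects\<close>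

text \<open>
  The direct image of the empty set is the largest object whose stalk is empty, by
  \<open>stalk_empty_iff\<close>.
\<close>

definition empty_stalk_part :: "('u, 'o, 'm) point_data \<Rightarrow> 'o" where
  "empty_stalk_part p = on_obj (direct_image p) {}"

context
  fixes U :: "'u set set" and E :: "('o, 'm) cat" and p :: "('u, 'o, 'm) point_data"
  assumes U: "universe U" and p: "point U E p"
begin

lemma point_functor: "is_functor E (Set_cat U) (inverse_image p)"
  and point_limits: "preserves_finite_limits E (Set_cat U) (inverse_image p)"
  using p by (auto simp: point_def geometric_morphism_def adjoint_def)

lemma point_category: "category E" "category (Set_cat U)"
  using point_functor by (auto simp: is_functor_def)

lemma stalk_small: "u \<in> Obj E \<Longrightarrow> on_obj (inverse_image p) u \<in> U"
  using point_functor by (auto simp: is_functor_def Set_cat_def)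

lemma stalk_thin:
  assumes "thin_object E u"
  shows "thin_object (Set_cat U) (on_obj (inverse_image p) u)"
proof -
  have u: "u \<in> Obj E" "product E u u u (Id E u) (Id E u)"
    using assms thin_object_iff_product_self[OF point_category(1)] by blast+
  have "on_arr (inverse_image p) (Id E u) = Id (Set_cat U) (on_obj (inverse_image p) u)"
    using point_functor u(1) by (simp add: is_functor_def)
  with preserves_product[OF point_functor point_limits u(2,1,1)] stalk_small[OF u(1)] show ?thesis
    unfolding thin_object_iff_product_self[OF point_category(2)] by (simp add: Set_cat_def)
qed

lemma stalk_terminal_nonempty:
  assumes "terminal E t"
  shows "on_obj (inverse_image p) t \<noteq> {}"
proof -
  have "terminal (Set_cat U) (on_obj (inverse_image p) t)"
    using preserves_terminal[OF point_functor point_limits assms] .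
  then have "Hom (Set_cat U) {undefined} (on_obj (inverse_image p) t) \<noteq> {}"
    using universe_singleton[OF U, of undefined] by (auto simp: terminal_def Set_cat_def)
  then show ?thesis by (auto simp: Hom_Set_cat)
qed

text \<open>
  Elements of the stalks of \<open>u\<close> and \<open>v\<close>, seen as maps from a one-element set, pair up to an
  element of the stalk of the product. This is what makes \<open>empty_stalk_part p\<close> a prime element.
\<close>

lemma stalk_product_nonempty:
  assumes q: "product E u v q \<pi>\<^sub>1 \<pi>\<^sub>2" and uv: "u \<in> Obj E" "v \<in> Obj E"
    and ne: "on_obj (inverse_image p) u \<noteq> {}" "on_obj (inverse_image p) v \<noteq> {}"
  shows "on_obj (inverse_image p) q \<noteq> {}"
proof -
  note one = universe_singleton[OF U, of undefined]
  obtain f g where "f \<in> Hom (Set_cat U) {undefined} (on_obj (inverse_image p) u)"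
    "g \<in> Hom (Set_cat U) {undefined} (on_obj (inverse_image p) v)"
    using ne Hom_Set_cat_nonempty_iff[OF one stalk_small[OF uv(1)]]
      Hom_Set_cat_nonempty_iff[OF one stalk_small[OF uv(2)]] by blast
  from product_pair[OF point_category(2) preserves_product[OF point_functor point_limits q uv] this]
  show ?thesis by (auto simp: Hom_Set_cat)
qed

text \<open>
  Both facts transport along the bijection between arrows \<open>p\<^sup>*u \<rightarrow> {}\<close> and arrows
  \<open>u \<rightarrow> p\<^sub>*{}\<close>: a set has at most one map to the empty set, and it has one only if it is empty.
\<close>

lemma stalk_empty_iff:
  assumes "u \<in> Obj E"
  shows "on_obj (inverse_image p) u = {} \<longleftrightarrow> Hom E u (empty_stalk_part p) \<noteq> {}"
    and "f \<in> Hom E u (empty_stalk_part p) \<Longrightarrow> g \<in> Hom E u (empty_stalk_part p) \<Longrightarrow> f = g"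
proof -
  let ?A = "on_obj (inverse_image p) u"
  have e: "{} \<in> U" by (rule universe_empty[OF U])
  then have "{} \<in> Obj (Set_cat U)" by (simp add: Set_cat_def)
  then obtain \<theta> where bij: "bij_betw \<theta> (Hom (Set_cat U) ?A {}) (Hom E u (empty_stalk_part p))"
    using p assms unfolding point_def geometric_morphism_def adjoint_def empty_stalk_part_def by blast
  have "?A = {} \<longleftrightarrow> Hom (Set_cat U) ?A {} \<noteq> {}"
    using Hom_Set_cat_nonempty_iff[OF stalk_small[OF assms] e] by simp
  also have "\<dots> \<longleftrightarrow> Hom E u (empty_stalk_part p) \<noteq> {}"
    using bij_betw_imp_surj_on[OF bij] by auto
  finally show "?A = {} \<longleftrightarrow> Hom E u (empty_stalk_part p) \<noteq> {}" .
  have "x = y" if "x \<in> Hom (Set_cat U) ?A {}" "y \<in> Hom (Set_cat U) ?A {}" for x y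
    using that by (auto simp: Hom_Set_cat intro: PiE_ext)
  then show "f = g" if "f \<in> Hom E u (empty_stalk_part p)" "g \<in> Hom E u (empty_stalk_part p)"
    using that unfolding bij_betw_imp_surj_on[OF bij, symmetric] by (elim imageE) (metis (no_types))
qed

lemma empty_stalk_part_thin: "thin_object E (empty_stalk_part p)"
proof -
  have "is_functor (Set_cat U) E (direct_image p)"
    using p by (simp add: point_def geometric_morphism_def adjoint_def)
  then have "empty_stalk_part p \<in> Obj E"
    using universe_empty[OF U] by (auto simp: is_functor_def Set_cat_def empty_stalk_part_def)
  then show ?thesis
    using stalk_empty_iff(2) Hom_Obj(1)[OF point_category(1)] unfolding thin_object_def by blast
qed

lemma stalk_isomorphic_iff:
  assumes "thin_object E u" "thin_object E v"
  shows "isomorphic (Set_cat U) (on_obj (inverse_image p) u) (on_obj (inverse_image p) v) \<longleftrightarrow>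
    (on_obj (inverse_image p) u = {} \<longleftrightarrow> on_obj (inverse_image p) v = {})"
  using isomorphic_thin_object_iff[OF point_category(2) stalk_thin[OF assms(1)] stalk_thin[OF assms(2)]]
    assms by (auto simp: thin_object_def Hom_Set_cat_nonempty_iff stalk_small)

lemma stalk_one_iff:
  assumes u: "thin_object E u"
  shows "(\<exists>t. terminal (Set_cat U) t \<and> isomorphic (Set_cat U) (on_obj (inverse_image p) u) t) \<longleftrightarrow>
    on_obj (inverse_image p) u \<noteq> {}"
proof
  assume "\<exists>t. terminal (Set_cat U) t \<and> isomorphic (Set_cat U) (on_obj (inverse_image p) u) t"
  then obtain t where t: "terminal (Set_cat U) t"
      "isomorphic (Set_cat U) (on_obj (inverse_image p) u) t" by blast
  then have "Hom (Set_cat U) {undefined} t \<noteq> {}"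
    using universe_singleton[OF U, of undefined] by (auto simp: terminal_def Set_cat_def)
  then have "t \<noteq> {}" by (auto simp: Hom_Set_cat)
  then show "on_obj (inverse_image p) u \<noteq> {}" using isomorphic_Set_cat_empty_iff[OF t(2)] by simp
next
  let ?A = "on_obj (inverse_image p) u"
  assume ne: "?A \<noteq> {}"
  have t: "terminal (Set_cat U) {undefined}" by (rule terminal_Set_cat_singleton[OF U])
  then have "thin_object (Set_cat U) {undefined}"
    by (rule terminal_thin_object[OF point_category(2)])
  then have "isomorphic (Set_cat U) ?A {undefined}"
    using isomorphic_thin_object_iff[OF point_category(2) stalk_thin[OF u]] ne u
    by (simp add: Hom_Set_cat_nonempty_iff stalk_small universe_singleton[OF U] thin_object_def)
  with t show "\<exists>t. terminal (Set_cat U) t \<and> isomorphic (Set_cat U) ?A t" by blast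
qed

end

section \<open>The topology on the index set\<close>

lemma points_isomorphic_stalk_empty_iff:
  assumes "points_isomorphic U E p q" "u \<in> Obj E"
  shows "on_obj (inverse_image p) u = {} \<longleftrightarrow> on_obj (inverse_image q) u = {}"
proof -
  have "isomorphic (Set_cat U) (on_obj (inverse_image p) u) (on_obj (inverse_image q) u)"
    using assms unfolding points_isomorphic_def naturally_isomorphic_def isomorphic_def by blast
  then show ?thesis by (rule isomorphic_Set_cat_empty_iff)
qed

text \<open>
  The definition asks for some representative \<open>v\<close> of \<open>c\<close> with one-element stalk; as isomorphic
  objects have arrows to the same objects, in particular to \<open>empty_stalk_part (i x)\<close>, any
  representative will do.
\<close>

lemma mem_subterminal_map_iff:
  assumes U: "universe U" and topos: "elementary_topos E" and p: "point U E (i x)" and x: "x \<in> X"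
    and \<Gamma>: "\<Gamma> \<subseteq> carrier (Sub_one E)" and c: "c \<in> \<Gamma>" "u \<in> c"
  shows "x \<in> subterminal_map U \<Gamma> X i c \<longleftrightarrow> on_obj (inverse_image (i x)) u \<noteq> {}"
proof -
  have *: "thin_object E v" "c = iso_class E v" if "v \<in> c" for v
    using iso_class_of_mem[OF topos _ that] \<Gamma> c(1) by auto
  have "on_obj (inverse_image (i x)) v = {} \<longleftrightarrow> on_obj (inverse_image (i x)) u = {}" if "v \<in> c" for v
  proof -
    have "isomorphic E u v" using *(2)[OF c(2)] that by (simp add: iso_class_def)
    then have "Hom E u v \<noteq> {}" "Hom E v u \<noteq> {}" by (auto simp: isomorphic_def)
    then have "Hom E v (empty_stalk_part (i x)) \<noteq> {} \<longleftrightarrow> Hom E u (empty_stalk_part (i x)) \<noteq> {}"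
      using Hom_trans[OF topos_category[OF topos]] by metis
    moreover have "u \<in> Obj E" "v \<in> Obj E"
      using *(1)[OF c(2)] *(1)[OF that] by (simp_all add: thin_object_def)
    ultimately show ?thesis by (simp add: stalk_empty_iff(1)[OF U p])
  qed
  then have "(\<exists>t. terminal (Set_cat U) t \<and> isomorphic (Set_cat U) (on_obj (inverse_image (i x)) v) t) \<longleftrightarrow>
      on_obj (inverse_image (i x)) u \<noteq> {}" if "v \<in> c" for v
    using that stalk_one_iff[OF U p *(1)[OF that]] by simp
  moreover have "x \<in> subterminal_map U \<Gamma> X i c \<longleftrightarrow> (\<exists>v\<in>c. \<exists>t. terminal (Set_cat U) t \<and>
      isomorphic (Set_cat U) (on_obj (inverse_image (i x)) v) t)"
    using x c(1) by (simp add: subterminal_map_def)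
  ultimately show ?thesis using c(2) by blast
qed

text \<open>
  Points of \<open>P\<close> are reached by \<open>i\<close> only up to isomorphism, which is enough because isomorphic
  points have the same objects with empty stalk.
\<close>

lemma separates_iff_inj_on:
  assumes U: "universe U" and topos: "elementary_topos E" and P: "\<forall>p\<in>P. point U E p"
    and i: "indexing U E X P i" and \<Gamma>: "\<Gamma> \<subseteq> carrier (Sub_one E)"
  shows "separates_subterminals U E P \<Gamma> \<longleftrightarrow> inj_on (subterminal_map U \<Gamma> X i) \<Gamma>"
proof
  let ?\<phi> = "subterminal_map U \<Gamma> X i"
  have iP: "i x \<in> P" "point U E (i x)" if "x \<in> X" for x
    using i P that by (auto simp: indexing_def)
  note mem_iff = mem_subterminal_map_iff[where E = E and i = i and \<Gamma> = \<Gamma>, OF U topos iP(2) _ \<Gamma>]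
  have thin: "thin_object E u" "c = iso_class E u" if "c \<in> \<Gamma>" "u \<in> c" for c u
    using iso_class_of_mem[OF topos _ that(2)] \<Gamma> that(1) by auto
  {
    assume sep: "separates_subterminals U E P \<Gamma>"
    show "inj_on ?\<phi> \<Gamma>"
    proof (rule inj_onI, rule ccontr)
      fix c d assume c: "c \<in> \<Gamma>" and d: "d \<in> \<Gamma>" and eq: "?\<phi> c = ?\<phi> d" and "c \<noteq> d"
      obtain u v where u: "u \<in> c" and v: "v \<in> d"
        using c d \<Gamma> Sub_one_cases[OF topos] self_mem_iso_class[OF topos] by (metis subsetD)
      have uv: "thin_object E u" "thin_object E v" using thin c d u v by blast+
      have "\<not> isomorphic E u v"
      proof
        assume "isomorphic E u v"
        then have "v \<in> c" using thin(2)[OF c u] uv by (simp add: iso_class_def thin_object_def)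
        then show False using thin(2)[OF c] thin(2)[OF d v] \<open>c \<noteq> d\<close> by blast
      qed
      then obtain p where p: "p \<in> P"
        and ni: "\<not> isomorphic (Set_cat U) (on_obj (inverse_image p) u) (on_obj (inverse_image p) v)"
        using sep c d u v unfolding separates_subterminals_def by blast
      have "point U E p" using P p by blast
      from stalk_isomorphic_iff[OF U this uv] ni
      have ne: "on_obj (inverse_image p) u = {} \<longleftrightarrow> on_obj (inverse_image p) v \<noteq> {}" by simp
      obtain x where x: "x \<in> X" "points_isomorphic U E (i x) p"
        using i p unfolding indexing_def by blast
      have "x \<in> ?\<phi> c \<longleftrightarrow> x \<notin> ?\<phi> d"
        using ne points_isomorphic_stalk_empty_iff[OF x(2)] uv
        by (simp add: mem_iff[OF x(1,1) c u] mem_iff[OF x(1,1) d v] thin_object_def)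
      then show False using eq by simp
    qed
  next
    assume inj: "inj_on ?\<phi> \<Gamma>"
    show "separates_subterminals U E P \<Gamma>"
      unfolding separates_subterminals_def
    proof (intro ballI impI)
      fix u v assume "u \<in> \<Union>\<Gamma>" "v \<in> \<Union>\<Gamma>" and ni: "\<not> isomorphic E u v"
      then obtain c d where c: "c \<in> \<Gamma>" "u \<in> c" and d: "d \<in> \<Gamma>" "v \<in> d" by blast
      have "c \<noteq> d" using ni thin(2)[OF c] d(2) by (auto simp: iso_class_def)
      then have "?\<phi> c \<noteq> ?\<phi> d" using inj c d by (auto simp: inj_on_def)
      moreover have "?\<phi> c \<subseteq> X" "?\<phi> d \<subseteq> X" using c d by (auto simp: subterminal_map_def)
      ultimately obtain x where x: "x \<in> X" "x \<in> ?\<phi> c \<longleftrightarrow> x \<notin> ?\<phi> d" by blast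
      then have "\<not> isomorphic (Set_cat U) (on_obj (inverse_image (i x)) u) (on_obj (inverse_image (i x)) v)"
        using stalk_isomorphic_iff[OF U iP(2)[OF x(1)] thin(1)[OF c] thin(1)[OF d]]
        by (auto simp: mem_iff[OF x(1,1) c] mem_iff[OF x(1,1) d])
      then show "\<exists>p\<in>P. \<not> isomorphic (Set_cat U) (on_obj (inverse_image p) u) (on_obj (inverse_image p) v)"
        using iP(1)[OF x(1)] by blast
    qed
  }
qed

text \<open>
  The lattice-theoretic result applies to the primes \<open>W x\<close>, the isomorphism classes of the direct
  images of the empty set.
\<close>

lemma subterminal_topology:
  assumes U: "universe U" and topos: "elementary_topos E" and small: "locally_small U E"
    and cocomp: "cocomplete U E" and \<Gamma>: "subframe \<Gamma> (Sub_one E)"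
    and P: "\<forall>p\<in>P. point U E p" and i: "indexing U E X P i"
  shows "topology_on X (subterminal_opens U \<Gamma> X i)"
    and "separates_subterminals U E P \<Gamma> \<longleftrightarrow>
      frame_iso ((Sub_one E)\<lparr>carrier := \<Gamma>\<rparr>)
        (opens_frame (topology (\<lambda>S. S \<in> subterminal_opens U \<Gamma> X i))) (subterminal_map U \<Gamma> X i)"
proof -
  let ?L = "Sub_one E"
  define W where "W x = iso_class E (empty_stalk_part (i x))" for x
  have ix: "point U E (i x)" if "x \<in> X" for x using P i that by (auto simp: indexing_def)
  have \<Gamma>L: "\<Gamma> \<subseteq> carrier ?L" using \<Gamma> by (simp add: subframe_def)
  have le_W: "iso_class E u \<sqsubseteq>\<^bsub>?L\<^esub> W x \<longleftrightarrow> on_obj (inverse_image (i x)) u = {}"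
    if "x \<in> X" "thin_object E u" for x u
    using Sub_one_le_iff[OF topos that(2) empty_stalk_part_thin[OF U ix[OF that(1)]]]
      stalk_empty_iff(1)[OF U ix[OF that(1)]] that(2) by (simp add: W_def thin_object_def)
  have "W x \<in> carrier ?L" if "x \<in> X" for x
    unfolding W_def by (rule iso_class_carrier[OF topos empty_stalk_part_thin[OF U ix[OF that]]])
  moreover have "\<not> \<top>\<^bsub>?L\<^esub> \<sqsubseteq>\<^bsub>?L\<^esub> W x" if x: "x \<in> X" for x
  proof -
    obtain t where t: "terminal E t"
      using topos_closed[OF topos] unfolding cartesian_closed_def by blast
    then have "thin_object E t"
      by (rule terminal_thin_object[OF topos_category[OF topos]])
    then show ?thesis
      using le_W[OF x] stalk_terminal_nonempty[OF U ix[OF x] t] by (simp add: Sub_one_top[OF topos t])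
  qed
  moreover have "a \<sqsubseteq>\<^bsub>?L\<^esub> W x \<or> b \<sqsubseteq>\<^bsub>?L\<^esub> W x"
    if x: "x \<in> X" and ab: "a \<in> carrier ?L" "b \<in> carrier ?L" "a \<sqinter>\<^bsub>?L\<^esub> b \<sqsubseteq>\<^bsub>?L\<^esub> W x" for x a b
  proof -
    obtain u where u: "thin_object E u" "a = iso_class E u" using ab(1) by (rule Sub_one_cases[OF topos])
    obtain v where v: "thin_object E v" "b = iso_class E v" using ab(2) by (rule Sub_one_cases[OF topos])
    obtain q \<pi>\<^sub>1 \<pi>\<^sub>2 where q: "product E u v q \<pi>\<^sub>1 \<pi>\<^sub>2" using topos_product[OF topos u(1) v(1)] .
    have "thin_object E q" by (rule thin_object_product[OF topos_category[OF topos] u(1) v(1) q])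
    then have "on_obj (inverse_image (i x)) q = {}"
      using ab(3) le_W[OF x] by (simp add: u v Sub_one_meet[OF topos u(1) v(1) q])
    then show ?thesis
      using stalk_product_nonempty[OF U ix[OF x] q] u v le_W[OF x] by (auto simp: thin_object_def)
  qed
  moreover have "subterminal_map U \<Gamma> X i c = {x \<in> X. \<not> c \<sqsubseteq>\<^bsub>?L\<^esub> W x}" if c: "c \<in> \<Gamma>" for c
  proof -
    obtain u where u: "thin_object E u" "c = iso_class E u"
      using \<Gamma>L c by (auto elim: Sub_one_cases[OF topos])
    then have "u \<in> c" using self_mem_iso_class[OF topos] by simp
    moreover have "subterminal_map U \<Gamma> X i c \<subseteq> X" using c by (auto simp: subterminal_map_def)
    ultimately show ?thesis
      using mem_subterminal_map_iff[where E = E and i = i, OF U topos ix _ \<Gamma>L c] le_W u by auto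
  qed
  ultimately have "topology_on X (subterminal_map U \<Gamma> X i ` \<Gamma>)"
    and "frame_iso (?L\<lparr>carrier := \<Gamma>\<rparr>) (opens_frame (topology (\<lambda>S. S \<in> subterminal_map U \<Gamma> X i ` \<Gamma>)))
      (subterminal_map U \<Gamma> X i) \<longleftrightarrow> inj_on (subterminal_map U \<Gamma> X i) \<Gamma>"
    using prime_elements_topology[OF Sub_one_frame[OF topos U small cocomp] \<Gamma>, of X W] by blast+
  then show "topology_on X (subterminal_opens U \<Gamma> X i)"
    and "separates_subterminals U E P \<Gamma> \<longleftrightarrow>
      frame_iso (?L\<lparr>carrier := \<Gamma>\<rparr>)
        (opens_frame (topology (\<lambda>S. S \<in> subterminal_opens U \<Gamma> X i))) (subterminal_map U \<Gamma> X i)"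
    by (simp_all add: subterminal_opens_def separates_iff_inj_on[OF U topos P i \<Gamma>L])
qed

theorem theorem2p3:
  fixes U :: "'u set set"
    and E :: "('o, 'm) cat"
    and \<Gamma> :: "'o set set"
    and X :: "'x set"
    and P :: "('u, 'o, 'm) point_data set"
    and i :: "'x \<Rightarrow> ('u, 'o, 'm) point_data"
  assumes "universe U"
    and "elementary_topos E"
    and "locally_small U E"
    and "cocomplete U E"
    and "subframe \<Gamma> (Sub_one E)"
    and "\<forall>p\<in>P. point U E p"
    and "indexing U E X P i"
  shows "topology_on X (subterminal_opens U \<Gamma> X i)
    \<and> (separates_subterminals U E P \<Gamma> \<longleftrightarrow>
           frame_iso ((Sub_one E)\<lparr>carrier := \<Gamma>\<rparr>)
             (opens_frame (topology (\<lambda>S. S \<in> subterminal_opens U \<Gamma> X i)))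
             (subterminal_map U \<Gamma> X i))
    \<and> (separates_subterminals U E P (carrier (Sub_one E)) \<longrightarrow>
           frame_iso (Sub_one E)
             (opens_frame (topology (\<lambda>S. S \<in> subterminal_opens U (carrier (Sub_one E)) X i)))
             (subterminal_map U (carrier (Sub_one E)) X i))"
proof -
  have "complete_lattice (Sub_one E)"
    using Sub_one_frame[OF assms(2,1,3,4)] by (simp add: is_frame_def)
  then have full: "subframe (carrier (Sub_one E)) (Sub_one E)" by (rule subframe_carrier)
  have "(Sub_one E)\<lparr>carrier := carrier (Sub_one E)\<rparr> = Sub_one E" by simp
  then show ?thesis
    using subterminal_topology[OF assms] subterminal_topology(2)[OF assms(1-4) full assms(6,7)]
    by simp
qed

end
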